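(* Let $\mathcal M_{\mathbf k}\subset\mathbb R^{N_1\times\dots\times N_d}$ be a finite-dimensional TT manifold of fixed TT rank $\mathbf k$. Let $X,Y\in \mathcal M_{\mathbf k}$ and $\sigma = \mathrm{dist}(X,\overline{\mathcal M}_{\mathbf k}\setminus\mathcal M_{\mathbf k})$. Then \[ \max_{\| Z\| = 1} \|(P_X-P_Y) Z\| \leq \frac{4d}{\sigma}\|X-Y\| \] and \[ \|(\mathrm{id}-P_X)(X-Y)\| \leq \frac{\sqrt{d-1}}{\sigma}\|X-Y\|^2. \] Furthermore, the last inequality holds more generally for $Y\in \overline{\mathcal M}_{\mathbf k}$.
   Context: A tensor $X\in\mathbb R^{N_1\times\dots\times N_d}$ has a tensor train (TT) representation of size $\mathbf k=(k_1,\dots,k_{d-1})$ if $X(i_1,\dots,i_d)=G_1(i_1)G_2(i_2)\cdots G_d(i_d)$ with matrices $G_\mu(i_\mu)\in\mathbb R^{k_{\mu-1}\times k_\mu}$, where $k_0=k_d=1$. The componentwise minimal possible tuple $\mathbf k$ is called the TT rank of $X$. $\mathcal M_{\mathbf k}$ is the set of tensors in $\mathbb R^{N_1\times\dots\times N_d}$ of TT rank exactly $\mathbf k$, which is an embedded submanifold; $\overline{\mathcal M}_{\mathbf k}$ is its closure. $\|\cdot\|$ is the Frobenius norm and $\mathrm{dist}$ the corresponding distance. $P_X$ is the orthogonal projection of $\mathbb R^{N_1\times\dots\times N_d}$ onto the tangent space $T_X\mathcal M_{\mathbf k}$. *)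

theory Defs
  imports "HOL-Analysis.Analysis" "Jordan_Normal_Form.Matrix"
begin

definition multi_indices :: "nat \<Rightarrow> (nat \<Rightarrow> nat) \<Rightarrow> (nat \<Rightarrow> nat) set" where
  "multi_indices d N = (\<Pi>\<^sub>E \<mu>\<in>{1..d}. {1..N \<mu>})"

text \<open>
  A tensor in \<open>\<real>\<^bsup>N\<^sub>1 \<times> \<dots> \<times> N\<^sub>d\<^esup>\<close> is an element \<open>X :: real ^ 'i\<close>, where \<open>'i\<close> is an arbitrary finite
  type whose elements label the multi-indices bijectively:
  \<open>bij_betw ix UNIV (multi_indices d N)\<close>. The entry of \<open>X\<close> at the multi-index \<open>ix p\<close> is the
  component of \<open>X\<close> at \<open>p\<close>, and the norm of \<open>real ^ 'i\<close> is the Frobenius norm.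
\<close>

primrec core_prod :: "(nat \<Rightarrow> nat \<Rightarrow> real mat) \<Rightarrow> (nat \<Rightarrow> nat) \<Rightarrow> nat \<Rightarrow> real mat" where
  "core_prod G i 0 = 1\<^sub>m 1"
| "core_prod G i (Suc \<mu>) = core_prod G i \<mu> * G (Suc \<mu>) (i (Suc \<mu>))"

text \<open>
  The size tuple \<open>(k\<^sub>1, \<dots>, k\<^bsub>d-1\<^esub>)\<close> is extended by the boundary values \<open>k 0 = k d = 1\<close>; values of
  \<open>k\<close> beyond \<open>d\<close> are irrelevant. The matrix product is 1 by 1 and is identified with its entry.
  Sizes \<open>k \<mu> = 0\<close> are allowed: for \<open>d \<ge> 2\<close> the zero tensor has TT rank \<open>(0, \<dots>, 0)\<close>.
\<close>

definition has_tt_repr ::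
  "nat \<Rightarrow> (nat \<Rightarrow> nat) \<Rightarrow> ('i::finite \<Rightarrow> nat \<Rightarrow> nat) \<Rightarrow> (nat \<Rightarrow> nat) \<Rightarrow> real ^ 'i \<Rightarrow> bool" where
  "has_tt_repr d N ix k X \<longleftrightarrow>
     k 0 = 1 \<and> k d = 1 \<and>
     (\<exists>G. (\<forall>\<mu>\<in>{1..d}. \<forall>j\<in>{1..N \<mu>}. G \<mu> j \<in> carrier_mat (k (\<mu> - 1)) (k \<mu>)) \<and>
          (\<forall>p. vec_nth X p = core_prod G (ix p) d $$ (0, 0)))"

definition has_tt_rank ::
  "nat \<Rightarrow> (nat \<Rightarrow> nat) \<Rightarrow> ('i::finite \<Rightarrow> nat \<Rightarrow> nat) \<Rightarrow> (nat \<Rightarrow> nat) \<Rightarrow> real ^ 'i \<Rightarrow> bool" where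
  "has_tt_rank d N ix k X \<longleftrightarrow>
     has_tt_repr d N ix k X \<and>
     (\<forall>k'. has_tt_repr d N ix k' X \<longrightarrow> (\<forall>\<mu>\<in>{1..<d}. k \<mu> \<le> k' \<mu>))"

definition tt_manifold ::
  "nat \<Rightarrow> (nat \<Rightarrow> nat) \<Rightarrow> ('i::finite \<Rightarrow> nat \<Rightarrow> nat) \<Rightarrow> (nat \<Rightarrow> nat) \<Rightarrow> (real ^ 'i) set" where
  "tt_manifold d N ix k = {X. has_tt_rank d N ix k X}"

text \<open>
  For an embedded submanifold \<open>M\<close> of a Euclidean space the tangent space at \<open>X \<in> M\<close> consists of the
  velocities at \<open>X\<close> of the continuously differentiable curves in \<open>M\<close>.
\<close>

definition tangent_space :: "'a::real_normed_vector set \<Rightarrow> 'a \<Rightarrow> 'a set" where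
  "tangent_space M X =
     {v. \<exists>\<gamma> \<epsilon>. \<epsilon> > 0 \<and> \<gamma> C1_differentiable_on {-\<epsilon><..<\<epsilon>} \<and> \<gamma> ` {-\<epsilon><..<\<epsilon>} \<subseteq> M \<and>
         \<gamma> 0 = X \<and> (\<gamma> has_vector_derivative v) (at 0)}"

definition orth_proj :: "'a::real_inner set \<Rightarrow> 'a \<Rightarrow> 'a" where
  "orth_proj T z = (THE p. p \<in> T \<and> (\<forall>v\<in>T. inner (z - p) v = 0))"

lemma orth_proj_ex1:
  fixes T :: "'a::euclidean_space set"
  assumes "subspace T"
  shows "\<exists>!p. p \<in> T \<and> (\<forall>v\<in>T. inner (z - p) v = 0)"
proof -
  obtain y w where y: "y \<in> span T" and w: "\<And>v. v \<in> span T \<Longrightarrow> inner w v = 0" and z: "z = y + w"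
    using orthogonal_subspace_decomp_exists[of T z] unfolding Linear_Algebra.orthogonal_def by metis
  have T: "span T = T" using assms by simp
  show ?thesis
  proof (rule ex1I[of _ y])
    show "y \<in> T \<and> (\<forall>v\<in>T. inner (z - y) v = 0)" using y w z T by simp
  next
    fix p assume p: "p \<in> T \<and> (\<forall>v\<in>T. inner (z - p) v = 0)"
    have d: "y - p \<in> T" using p y T assms by (auto intro: subspace_diff)
    have "inner (z - p) (y - p) = 0" "inner (z - y) (y - p) = 0"
      using p d w z T by auto
    then have "inner (y - p) (y - p) = 0"
      by (simp add: inner_diff_left)
    then show "p = y" by simp
  qed
qed

lemma orth_proj:
  fixes T :: "'a::euclidean_space set"
  assumes "subspace T"
  shows "orth_proj T z \<in> T" "v \<in> T \<Longrightarrow> inner (z - orth_proj T z) v = 0"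
  using theI'[OF orth_proj_ex1[OF assms, of z]] unfolding orth_proj_def by auto

definition tangent_proj ::
  "nat \<Rightarrow> (nat \<Rightarrow> nat) \<Rightarrow> ('i::finite \<Rightarrow> nat \<Rightarrow> nat) \<Rightarrow> (nat \<Rightarrow> nat) \<Rightarrow> real ^ 'i \<Rightarrow> real ^ 'i \<Rightarrow> real ^ 'i"
  where
  "tangent_proj d N ix k X = orth_proj (tangent_space (tt_manifold d N ix k) X)"

text \<open>
  The distance \<open>\<sigma>\<close> of \<open>X\<close> to \<open>closure M - M\<close>. If this set is empty (\<open>d = 1\<close>, or \<open>k\<close> is zero between
  the boundary values), the distance is infinite and \<open>c / \<sigma>\<close> is to be read as zero. This agrees with
  the library conventions \<open>infdist X {} = 0\<close> and \<open>c / 0 = 0\<close>. For \<open>X \<in> M\<close> and a nonempty set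
  \<open>closure M - M\<close> one has \<open>\<sigma> > 0\<close>.
\<close>

definition boundary_dist ::
  "nat \<Rightarrow> (nat \<Rightarrow> nat) \<Rightarrow> ('i::finite \<Rightarrow> nat \<Rightarrow> nat) \<Rightarrow> (nat \<Rightarrow> nat) \<Rightarrow> real ^ 'i \<Rightarrow> real" where
  "boundary_dist d N ix k X =
     infdist X (closure (tt_manifold d N ix k) - tt_manifold d N ix k)"

end

theory Submission
  imports Defs
begin

text \<open>
  Let \<open>L\<^sub>\<mu>\<close> and \<open>R\<^sub>\<mu>\<close> be the orthogonal projections that act on the first \<open>\<mu>\<close> indices by projecting onto the
  column space of the \<open>\<mu>\<close>-th unfolding of \<open>X\<close>, and on the remaining indices by projecting onto its row
  space, with \<open>L\<^sub>0 = id\<close>. The \<open>L\<^sub>\<mu>\<close> form a decreasing chain, and \<open>L\<^sub>\<mu>\<close> commutes with \<open>R\<^sub>\<nu>\<close> for \<open>\<mu> \<le> \<nu>\<close>, because the two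
  act on disjoint sets of indices. Hence \<open>normal_proj\<close>, the map
  \<open>Q = (L\<^sub>0 - L\<^sub>1) (id - R\<^sub>1) + \<dots> + (L\<^bsub>d-2\<^esub> - L\<^bsub>d-1\<^esub>) (id - R\<^bsub>d-1\<^esub>)\<close>, is an orthogonal projection, a
  sum of projections with orthogonal ranges. Its complement is the tangent projection \<open>P\<^sub>X\<close>.

  Both estimates hold with a lower bound \<open>s\<close> for the nonzero singular values of all unfoldings of \<open>X\<close> in place of
  the distance \<open>\<sigma>\<close>. If \<open>Y\<close> has the same ranks as \<open>X\<close>, the gaps between the column spaces, and between
  the row spaces, of \<open>X\<close> and \<open>Y\<close> are at most \<open>\<delta> = \<parallel>X - Y\<parallel> / s\<close> (\<open>colspace_gap\<close>); equality of the ranks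
  makes the gap symmetric (\<open>gap_symmetric\<close>). So each projection moves by at most \<open>\<delta>\<close>, and the triangle
  inequality gives \<open>\<parallel>P\<^sub>X - P\<^sub>Y\<parallel> \<le> 3 (d - 1) \<delta>\<close>. For the second estimate \<open>Q (X - Y) = - Q Y\<close>, where the summand
  \<open>(L\<^sub>\<mu>\<^sub>-\<^sub>1 - L\<^sub>\<mu>) (id - R\<^sub>\<mu>) Y\<close> is of second order: the factor \<open>id - R\<^sub>\<mu>\<close> gives \<open>\<parallel>X - Y\<parallel>\<close>, since it
  annihilates \<open>X\<close>, and the factor \<open>id - L\<^sub>\<mu>\<close> gives \<open>\<delta>\<close>, since it is applied to columns from the column space of
  \<open>Y\<close>. Pythagoras over the \<open>d - 1\<close> summands gives the factor \<open>sqrt (d - 1)\<close>. The case of \<open>Y\<close> in the closure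
  follows by continuity.

  Three facts connect this with the manifold. First, a tensor has TT rank \<open>k\<close> exactly if its unfoldings have
  the ranks \<open>k \<mu>\<close> (\<open>tt_manifold_iff_ranks\<close>). Second, \<open>\<sigma>\<close> is an admissible \<open>s\<close>
  (\<open>infdist_singular_bounds\<close>): for a unit vector \<open>u\<close> in a column space, removing the component along \<open>u\<close> from all
  columns is both an operation from the left and an operation from the right, and both are limits of
  invertible ones; so the result is a boundary point, at the distance \<open>\<parallel>X\<^sup>T u\<parallel>\<close>. That \<open>\<sigma>\<close> is positive is the
  semicontinuity of rank. Third, the velocities of curves through \<open>X\<close> form the kernel of \<open>Q\<close>
  (\<open>tangent_space_stratum\<close>): a velocity is in the kernel because \<open>Q (X - Y)\<close> is quadratic in \<open>X - Y\<close>, and a vector of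
  the kernel is a sum of pieces \<open>A\<^sub>\<mu> X\<close>, with \<open>A\<^sub>\<mu>\<close> acting on the first \<open>\<mu>\<close> indices, each of which can also be
  obtained by acting on the indices from \<open>\<mu>\<close> on; applying the factors \<open>id + t A\<^sub>\<mu>\<close> in the right
  order to \<open>X\<close> keeps all ranks.
\<close>

(* The symbol $ is to denote components of real^n only. *)
no_notation vec_index (infixl "$" 100)

section \<open>Orthogonal projections and the gap between subspaces\<close>

lemma orth_proj_eqI:
  fixes S :: "'a::euclidean_space set"
  assumes "subspace S" "p \<in> S" "\<And>v. v \<in> S \<Longrightarrow> inner (z - p) v = 0"
  shows "orth_proj S z = p"
  using orth_proj_ex1[OF assms(1), of z] orth_proj(1)[OF assms(1), of z]
    orth_proj(2)[OF assms(1), of _ z] assms(2,3) by blast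

lemma linear_orth_proj:
  fixes S :: "'a::euclidean_space set"
  assumes S: "subspace S"
  shows "linear (orth_proj S)"
proof (rule linearI)
  fix x y :: 'a and c :: real
  show "orth_proj S (x + y) = orth_proj S x + orth_proj S y"
  proof (rule orth_proj_eqI[OF S])
    show "orth_proj S x + orth_proj S y \<in> S" by (simp add: S orth_proj(1) subspace_add)
    fix v assume "v \<in> S"
    then show "inner (x + y - (orth_proj S x + orth_proj S y)) v = 0"
      using orth_proj(2)[OF S, of v x] orth_proj(2)[OF S, of v y] by (simp add: inner_simps)
  qed
  show "orth_proj S (c *\<^sub>R x) = c *\<^sub>R orth_proj S x"
  proof (rule orth_proj_eqI[OF S])
    show "c *\<^sub>R orth_proj S x \<in> S" by (simp add: S orth_proj(1) subspace_scale)
    fix v assume "v \<in> S"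
    then show "inner (c *\<^sub>R x - c *\<^sub>R orth_proj S x) v = 0"
      using orth_proj(2)[OF S, of v x] by (simp add: inner_simps)
  qed
qed

lemma orth_proj_id:
  fixes S :: "'a::euclidean_space set"
  assumes "subspace S" "z \<in> S"
  shows "orth_proj S z = z"
  by (rule orth_proj_eqI) (use assms in auto)

lemma orth_proj_sym:
  fixes S :: "'a::euclidean_space set"
  assumes S: "subspace S"
  shows "inner (orth_proj S x) y = inner x (orth_proj S y)"
  using orth_proj(2)[OF S orth_proj(1)[OF S, of y], of x] orth_proj(2)[OF S orth_proj(1)[OF S, of x], of y]
  by (simp add: inner_simps inner_commute)

lemma orth_proj_pythagoras:
  fixes S :: "'a::euclidean_space set"
  assumes S: "subspace S"
  shows "(norm z)\<^sup>2 = (norm (orth_proj S z))\<^sup>2 + (norm (z - orth_proj S z))\<^sup>2"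
  using orth_proj(2)[OF S orth_proj(1)[OF S, of z], of z]
  by (simp add: power2_norm_eq_inner inner_simps inner_commute)

lemma norm_orth_proj_le:
  fixes S :: "'a::euclidean_space set"
  assumes S: "subspace S"
  shows "norm (orth_proj S z) \<le> norm z" "norm (z - orth_proj S z) \<le> norm z"
  using orth_proj_pythagoras[OF S, of z] by (auto intro: power2_le_imp_le[OF _ norm_ge_zero])

lemma norm_orth_compl_le_dist:
  fixes S :: "'a::euclidean_space set"
  assumes S: "subspace S" and "s \<in> S"
  shows "norm (z - orth_proj S z) \<le> norm (z - s)"
proof -
  have "orth_proj S (z - s) = orth_proj S z - s"
    using linear_diff[OF linear_orth_proj[OF S], of z s] orth_proj_id[OF assms] by simp
  then show ?thesis using norm_orth_proj_le(2)[OF S, of "z - s"] by simp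
qed

text \<open>Between subspaces of equal dimension the gap is symmetric. If it is below 1, the projection onto
\<open>T\<close> is injective on \<open>S\<close>, hence onto \<open>T\<close> because the dimensions agree; so every \<open>b\<close> in
\<open>T\<close> is the projection of some \<open>a\<close> in \<open>S\<close>, and the angle between \<open>a\<close> and \<open>b\<close> bounds the
distance of \<open>b\<close> to \<open>S\<close>. A gap of at least 1 is no restriction.\<close>
lemma gap_symmetric:
  fixes S T :: "'a::euclidean_space set"
  assumes S: "subspace S" and T: "subspace T" and dim: "dim S = dim T"
    and gap: "\<And>a. a \<in> S \<Longrightarrow> norm (a - orth_proj T a) \<le> \<delta> * norm a"
    and b: "b \<in> T"
  shows "norm (b - orth_proj S b) \<le> \<delta> * norm b"
proof (cases "\<delta> < 1 \<and> b \<noteq> 0")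
  case False
  then consider "\<not> \<delta> < 1" | "b = 0" by blast
  then show ?thesis
  proof cases
    case 1
    then have "norm b \<le> \<delta> * norm b" by (simp add: mult_le_cancel_right1)
    with norm_orth_proj_le(2)[OF S, of b] show ?thesis by linarith
  next
    case 2
    then show ?thesis using norm_orth_proj_le(2)[OF S, of b] by simp
  qed
next
  case True
  have inj: "a = 0" if "a \<in> S" "orth_proj T a = 0" for a
  proof (rule ccontr)
    assume "a \<noteq> 0"
    then have "\<delta> * norm a < norm a" using True by simp
    then show False using gap[OF that(1)] that(2) by simp
  qed
  have lin: "linear (orth_proj T)" by (rule linear_orth_proj[OF T])
  have injS: "inj_on (orth_proj T) (span S)"
  proof (rule inj_onI)
    fix x y assume "x \<in> span S" "y \<in> span S" "orth_proj T x = orth_proj T y"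
    then have "x - y \<in> S" "orth_proj T (x - y) = 0"
      using S span_eq_iff[THEN iffD2, OF S] by (auto simp: linear_diff[OF lin] subspace_diff)
    then show "x = y" using inj[of "x - y"] by simp
  qed
  have "dim (orth_proj T ` S) = dim S"
    by (rule dim_image_eq[OF lin injS])
  moreover have "orth_proj T ` S \<subseteq> T" using orth_proj(1)[OF T] by auto
  moreover have "subspace (orth_proj T ` S)" by (rule linear_subspace_image[OF lin S])
  ultimately have "orth_proj T ` S = T"
    using subspace_dim_equal[OF _ T] dim by auto
  then obtain a where a: "a \<in> S" "orth_proj T a = b" using b by (metis imageE)
  have pa: "(norm a)\<^sup>2 = (norm b)\<^sup>2 + (norm (a - b))\<^sup>2"
    using orth_proj_pythagoras[OF T, of a] a by simp
  have "a \<noteq> 0" using a True linear_0[OF lin] by auto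
  have "0 \<le> \<delta> * norm a" using gap[OF a(1)] norm_ge_zero[of "a - orth_proj T a"] by linarith
  then have d0: "\<delta> \<ge> 0" using \<open>a \<noteq> 0\<close> by (simp add: zero_le_mult_iff)
  have 1: "(norm (a - b))\<^sup>2 \<le> \<delta>\<^sup>2 * (norm a)\<^sup>2"
    using power_mono[OF gap[OF a(1)], of 2] a(2) by (simp add: power_mult_distrib)
  have 2: "inner b a = (norm b)\<^sup>2"
    using orth_proj(2)[OF T b, of a] a(2) by (simp add: power2_norm_eq_inner inner_simps inner_commute)
  have "inner b a = inner (orth_proj S b) a"
    using orth_proj(2)[OF S a(1), of b] by (simp add: inner_simps)
  also have "\<dots> \<le> norm (orth_proj S b) * norm a" by (rule norm_cauchy_schwarz)
  finally have "(norm b)\<^sup>2 \<le> norm (orth_proj S b) * norm a" using 2 by simp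
  from power_mono[OF this, of 2]
  have 3: "((norm b)\<^sup>2)\<^sup>2 \<le> (norm (orth_proj S b))\<^sup>2 * (norm a)\<^sup>2" by (simp add: power_mult_distrib)
  have 4: "(1 - \<delta>\<^sup>2) * (norm a)\<^sup>2 \<le> (norm b)\<^sup>2" using pa 1 by (simp add: algebra_simps)
  have "(norm b)\<^sup>2 * ((1 - \<delta>\<^sup>2) * (norm a)\<^sup>2) \<le> (norm b)\<^sup>2 * (norm b)\<^sup>2"
    by (rule mult_left_mono[OF 4]) simp
  also have "\<dots> \<le> (norm (orth_proj S b))\<^sup>2 * (norm a)\<^sup>2" using 3 by (simp add: power2_eq_square)
  finally have "((1 - \<delta>\<^sup>2) * (norm b)\<^sup>2) * (norm a)\<^sup>2 \<le> (norm (orth_proj S b))\<^sup>2 * (norm a)\<^sup>2"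
    by (simp add: algebra_simps)
  then have "(1 - \<delta>\<^sup>2) * (norm b)\<^sup>2 \<le> (norm (orth_proj S b))\<^sup>2"
    using \<open>a \<noteq> 0\<close> by simp
  then have "(norm (b - orth_proj S b))\<^sup>2 \<le> (\<delta> * norm b)\<^sup>2"
    using orth_proj_pythagoras[OF S, of b] by (simp add: algebra_simps power_mult_distrib)
  then show ?thesis by (rule power2_le_imp_le) (use d0 in simp)
qed

text \<open>The vector \<open>P\<^sub>S v - P\<^sub>T v\<close> is the difference of \<open>P\<^sub>S (v - P\<^sub>T v)\<close> and \<open>P\<^sub>T v - P\<^sub>S P\<^sub>T v\<close>. These
are orthogonal, one bounded by each gap, so Pythagoras loses no factor 2.\<close>
lemma norm_orth_proj_diff_le:
  fixes S T :: "'a::euclidean_space set"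
  assumes S: "subspace S" and T: "subspace T"
    and gapS: "\<And>a. a \<in> S \<Longrightarrow> norm (a - orth_proj T a) \<le> \<delta> * norm a"
    and gapT: "\<And>b. b \<in> T \<Longrightarrow> norm (b - orth_proj S b) \<le> \<delta> * norm b"
    and \<delta>: "\<delta> \<ge> 0"
  shows "norm (orth_proj S v - orth_proj T v) \<le> \<delta> * norm v"
proof -
  define u where "u = v - orth_proj T v"
  define p where "p = orth_proj S u"
  define q where "q = orth_proj T v - orth_proj S (orth_proj T v)"
  have pS: "p \<in> S" unfolding p_def by (rule orth_proj(1)[OF S])
  have split: "orth_proj S v - orth_proj T v = p - q"
    unfolding p_def q_def u_def using linear_diff[OF linear_orth_proj[OF S]] by simp
  have ort: "inner q p = 0" unfolding q_def by (rule orth_proj(2)[OF S pS])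
  have "(norm p)\<^sup>2 = inner u p"
    using orth_proj(2)[OF S pS, of u] unfolding p_def[symmetric]
    by (simp add: power2_norm_eq_inner inner_simps)
  also have "\<dots> = inner u (p - orth_proj T p)"
    using orth_proj(2)[OF T orth_proj(1)[OF T, of p], of v] unfolding u_def
    by (simp add: inner_simps)
  also have "\<dots> \<le> norm u * norm (p - orth_proj T p)" by (rule norm_cauchy_schwarz)
  \<comment> \<open>the adjoint of \<open>(id - P\<^sub>T) P\<^sub>S\<close> has the same norm, which is at most \<open>\<delta>\<close> by the gap of \<open>S\<close>\<close>
  also have "\<dots> \<le> norm u * (\<delta> * norm p)" by (rule mult_left_mono[OF gapS[OF pS]]) simp
  finally have "norm p * norm p \<le> (\<delta> * norm u) * norm p" by (simp add: power2_eq_square algebra_simps)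
  then have np: "norm p \<le> \<delta> * norm u"
    by (cases "p = 0") (use \<delta> in auto)
  have nq: "norm q \<le> \<delta> * norm (orth_proj T v)"
    unfolding q_def by (rule gapT[OF orth_proj(1)[OF T]])
  have "(norm (p - q))\<^sup>2 = (norm p)\<^sup>2 + (norm q)\<^sup>2"
    using ort by (simp add: power2_norm_eq_inner inner_simps inner_commute)
  also have "\<dots> \<le> (\<delta> * norm u)\<^sup>2 + (\<delta> * norm (orth_proj T v))\<^sup>2"
    by (intro add_mono power_mono np nq) auto
  also have "\<dots> = (\<delta> * norm v)\<^sup>2"
    using orth_proj_pythagoras[OF T, of v] unfolding u_def
    by (simp add: power_mult_distrib algebra_simps)
  finally show ?thesis unfolding split by (rule power2_le_imp_le) (use \<delta> in simp)
qed

section \<open>Unfoldings along a cut of the multi-index\<close>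

lemmas cart_eq_iff = Finite_Cartesian_Product.vec_eq_iff

text \<open>The multi-index that takes its left part from \<open>p\<close> and its right part from \<open>q\<close> is written \<open>g p q\<close>.
Such an operation is a rectangular band. The laws hold for every cut of the multi-index into a left and a
right part. Exchanging left and right is \<open>flip\<close>, so statements about
columns also yield statements about rows.\<close>
definition band :: "('i \<Rightarrow> 'i \<Rightarrow> 'i) \<Rightarrow> bool" where
  "band g \<longleftrightarrow> (\<forall>p q r. g p p = p \<and> g (g p q) r = g p r \<and> g p (g q r) = g p r)"

definition flip :: "('i \<Rightarrow> 'i \<Rightarrow> 'i) \<Rightarrow> 'i \<Rightarrow> 'i \<Rightarrow> 'i" where
  "flip g = (\<lambda>p q. g q p)"

lemma band_flip: "band g \<Longrightarrow> band (flip g)"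
  by (simp add: band_def flip_def)

lemma flip_flip [simp]: "flip (flip g) = g"
  by (simp add: flip_def)

lemma bandD:
  assumes "band g"
  shows "g p p = p" "g (g p q) r = g p r" "g p (g q r) = g p r"
  using assms by (auto simp: band_def)

text \<open>The map \<open>(p, s) \<mapsto> (g p s, g s p)\<close>, which swaps the right parts, is an involution.\<close>
lemma sum_band:
  fixes h :: "'i::finite \<Rightarrow> 'i \<Rightarrow> 'a::comm_monoid_add"
  assumes "band g"
  shows "(\<Sum>p\<in>UNIV. \<Sum>s\<in>UNIV. h (g p s) (g s p)) = (\<Sum>p\<in>UNIV. \<Sum>s\<in>UNIV. h p s)"
proof -
  have "(\<Sum>(p, s)\<in>UNIV. h (g p s) (g s p)) = (\<Sum>(p, s)\<in>UNIV. h p s)"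
    by (rule sum.reindex_bij_witness[where i = "\<lambda>(p, s). (g p s, g s p)" and j = "\<lambda>(p, s). (g p s, g s p)"])
      (auto simp: bandD[OF assms])
  then show ?thesis unfolding sum.cartesian_product UNIV_Times_UNIV .
qed

text \<open>The unfolding of \<open>X\<close> along a cut, with rows and columns labelled by full multi-indices instead of left
and right parts. Every row and every column is repeated, which keeps the rank and multiplies all singular
values by \<open>sqrt CARD('i)\<close>. In return the unfoldings along all cuts are square matrices
of one type.\<close>
definition flattening :: "('i \<Rightarrow> 'i \<Rightarrow> 'i) \<Rightarrow> real^'i \<Rightarrow> real^'i^'i" where
  "flattening g X = (\<chi> p q. X $ g p q)"

definition colspace :: "('i \<Rightarrow> 'i \<Rightarrow> 'i) \<Rightarrow> real^'i::finite \<Rightarrow> (real^'i) set" where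
  "colspace g X = range ((*v) (flattening g X))"

lemma subspace_colspace: "subspace (colspace g X)"
  unfolding colspace_def by (simp add: linear_subspace_image)

lemma flattening_mult: "(flattening g X *v w) $ p = (\<Sum>q\<in>UNIV. X $ g p q * w $ q)"
  by (simp add: flattening_def matrix_vector_mult_def)

lemma column_flattening: "column s (flattening g Z) $ p = Z $ g p s"
  by (simp add: column_def flattening_def)

lemma flattening_diff: "flattening g (X - Y) = flattening g X - flattening g Y"
  by (simp add: flattening_def cart_eq_iff)

lemma transpose_flattening: "transpose (flattening g X) = flattening (flip g) X"
  by (simp add: flattening_def transpose_def flip_def)

lemma column_mem_colspace: "column s (flattening g X) \<in> colspace g X"
  unfolding colspace_def by (metis matrix_vector_mult_basis rangeI)

lemma flattening_mult_columns:
  "flattening g X *v w = (\<Sum>q\<in>UNIV. w $ q *\<^sub>R column q (flattening g X))"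
  by (simp add: cart_eq_iff flattening_mult column_flattening mult.commute)

lemma colspace_subset_iff:
  "colspace g Z \<subseteq> S \<longleftrightarrow> (\<forall>s. column s (flattening g Z) \<in> S)" if "subspace S"
proof
  assume "colspace g Z \<subseteq> S"
  then show "\<forall>s. column s (flattening g Z) \<in> S" using column_mem_colspace by blast
next
  assume "\<forall>s. column s (flattening g Z) \<in> S"
  then show "colspace g Z \<subseteq> S"
    unfolding colspace_def flattening_mult_columns using that by (auto intro!: subspace_sum subspace_scale)
qed

lemma dim_colspace_flip: "dim (colspace (flip g) X) = dim (colspace g X)"
  unfolding colspace_def rank_dim_range[symmetric] transpose_flattening[symmetric] rank_transpose ..

lemma colspace_left:
  assumes "band g" "u \<in> colspace g X"
  shows "u $ g p s = u $ p"
  using assms(2) by (auto simp: colspace_def flattening_mult bandD[OF assms(1)])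

lemma column_band:
  assumes "band g"
  shows "column (g p s) (flattening g Z) = column s (flattening g Z)"
  by (simp add: cart_eq_iff column_flattening bandD[OF assms])

lemma eq_by_columns:
  assumes "band g" "\<And>s. column s (flattening g Z) = column s (flattening g W)"
  shows "Z = W"
proof -
  have "Z $ p = W $ p" for p
    using arg_cong[OF assms(2)[of p], of "\<lambda>v. v $ p"] by (simp add: column_flattening bandD[OF assms(1)])
  then show ?thesis by (simp add: cart_eq_iff)
qed

lemma sum_inner_columns:
  fixes Z W :: "real^'i::finite"
  assumes "band g"
  shows "(\<Sum>s\<in>UNIV. inner (column s (flattening g Z)) (column s (flattening g W))) = real CARD('i) * inner Z W"
proof -
  have "(\<Sum>s\<in>UNIV. inner (column s (flattening g Z)) (column s (flattening g W)))
      = (\<Sum>p\<in>UNIV. \<Sum>s\<in>UNIV. Z $ g p s * W $ g p s)"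
    by (subst sum.swap) (simp add: inner_vec_def column_flattening)
  also have "\<dots> = (\<Sum>p\<in>UNIV. \<Sum>s\<in>(UNIV::'i set). Z $ p * W $ p)"
    by (rule sum_band[OF assms, of "\<lambda>p s. Z $ p * W $ p"])
  also have "\<dots> = real CARD('i) * inner Z W"
    by (simp add: inner_vec_def sum_distrib_left)
  finally show ?thesis .
qed

lemma sum_norm_columns:
  fixes Z :: "real^'i::finite"
  assumes "band g"
  shows "(\<Sum>s\<in>UNIV. (norm (column s (flattening g Z)))\<^sup>2) = real CARD('i) * (norm Z)\<^sup>2"
  using sum_inner_columns[OF assms, of Z Z] by (simp add: power2_norm_eq_inner)

lemma norm_flattening_mult_le:
  fixes Z :: "real^'i::finite"
  assumes "band g"
  shows "norm (flattening g Z *v w) \<le> sqrt CARD('i) * norm Z * norm w"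
proof -
  have "norm (flattening g Z *v w) \<le> (\<Sum>q\<in>UNIV. \<bar>w $ q\<bar> * norm (column q (flattening g Z)))"
    unfolding flattening_mult_columns by (rule norm_sum[THEN order_trans]) simp
  also have "\<dots> \<le> L2_set (\<lambda>q. w $ q) UNIV * L2_set (\<lambda>q. norm (column q (flattening g Z))) UNIV"
    using L2_set_mult_ineq[of "\<lambda>q. w $ q" "\<lambda>q. norm (column q (flattening g Z))" UNIV] by simp
  also have "L2_set (\<lambda>q. norm (column q (flattening g Z))) UNIV = sqrt CARD('i) * norm Z"
    by (simp add: L2_set_def sum_norm_columns[OF assms] real_sqrt_mult)
  also have "L2_set (\<lambda>q. w $ q) UNIV = norm w"
    by (simp add: norm_vec_def L2_set_def)
  finally show ?thesis by (simp add: ac_simps)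
qed

lemma norm_le_by_columns:
  fixes Z W :: "real^'i::finite"
  assumes "band g" "c \<ge> 0"
    and "\<And>s. norm (column s (flattening g Z)) \<le> c * norm (column s (flattening g W))"
  shows "norm Z \<le> c * norm W"
proof -
  have "real CARD('i) * (norm Z)\<^sup>2 \<le> (\<Sum>s\<in>UNIV. (c * norm (column s (flattening g W)))\<^sup>2)"
    unfolding sum_norm_columns[OF assms(1), symmetric] by (intro sum_mono power_mono assms(3)) simp
  also have "\<dots> = real CARD('i) * (c * norm W)\<^sup>2"
    by (simp add: power_mult_distrib sum_distrib_left[symmetric] sum_norm_columns[OF assms(1)])
  finally have "(norm Z)\<^sup>2 \<le> (c * norm W)\<^sup>2" by simp
  then show ?thesis by (rule power2_le_imp_le) (use assms(2) in simp)
qed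

section \<open>Operators on one side of a cut\<close>

text \<open>The linear maps of the form \<open>id \<otimes> B\<close>, where \<open>B\<close> acts on the right parts: the kernel \<open>b p q\<close> depends on
\<open>p\<close> through its right part only, and the left part of the argument of \<open>Z\<close> stays that of \<open>p\<close>. The maps that
act on the left parts are those with \<open>acts_right (flip g)\<close>.\<close>
definition acts_right :: "('i \<Rightarrow> 'i \<Rightarrow> 'i) \<Rightarrow> (real^'i::finite \<Rightarrow> real^'i) \<Rightarrow> bool" where
  "acts_right g T \<longleftrightarrow> (\<exists>b. (\<forall>p q s. b (g s p) q = b p q) \<and>
     (\<forall>Z p. T Z $ p = (\<Sum>q\<in>UNIV. b p q * Z $ g p q)))"

lemma acts_rightI:
  assumes "\<And>p q s. b (g s p) q = b p q" "\<And>Z p. T Z $ p = (\<Sum>q\<in>UNIV. b p q * Z $ g p q)"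
  shows "acts_right g T"
  unfolding acts_right_def using assms by blast

lemma acts_rightE:
  assumes "acts_right g T"
  obtains b where "\<And>p q s. b (g s p) q = b p q" "\<And>Z p. T Z $ p = (\<Sum>q\<in>UNIV. b p q * Z $ g p q)"
  using assms unfolding acts_right_def by blast

lemma acts_right_linear:
  assumes "acts_right g T" shows "linear T"
proof -
  obtain b where "\<And>p q s. b (g s p) q = b p q" and b: "\<And>Z p. T Z $ p = (\<Sum>q\<in>UNIV. b p q * Z $ g p q)"
    by (rule acts_rightE[OF assms]) blast
  show ?thesis
    by (rule linearI) (simp_all add: cart_eq_iff b algebra_simps sum.distrib sum_distrib_left)
qed

lemma acts_right_id: assumes "band g" shows "acts_right g (\<lambda>Z. Z)"
proof (rule acts_rightI[where b = "\<lambda>p q. if q = g undefined p then 1 else 0"])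
  fix Z :: "real^'a" and p
  have "(\<Sum>q\<in>UNIV. (if q = g undefined p then 1 else 0) * Z $ g p q) = (\<Sum>q\<in>UNIV. if q = g undefined p then Z $ g p q else 0)"
    by (rule sum.cong) auto
  then show "Z $ p = (\<Sum>q\<in>UNIV. (if q = g undefined p then 1 else 0) * Z $ g p q)"
    by (simp add: bandD[OF assms])
qed (simp add: bandD[OF assms])

lemma acts_right_lincomb:
  assumes "acts_right g S" "acts_right g T"
  shows "acts_right g (\<lambda>Z. S Z + c *\<^sub>R T Z)"
proof -
  obtain a where a: "\<And>p q s. a (g s p) q = a p q" "\<And>Z p. S Z $ p = (\<Sum>q\<in>UNIV. a p q * Z $ g p q)"
    by (rule acts_rightE[OF assms(1)]) blast
  obtain b where b: "\<And>p q s. b (g s p) q = b p q" "\<And>Z p. T Z $ p = (\<Sum>q\<in>UNIV. b p q * Z $ g p q)"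
    by (rule acts_rightE[OF assms(2)]) blast
  show ?thesis
    by (rule acts_rightI[where b = "\<lambda>p q. a p q + c * b p q"])
      (simp_all add: a b algebra_simps sum.distrib sum_distrib_left)
qed

text \<open>Associativity says that the cut \<open>g0\<close> lies to the left of the cut \<open>g1\<close> (or coincides with it).\<close>
definition refines :: "('i \<Rightarrow> 'i \<Rightarrow> 'i) \<Rightarrow> ('i \<Rightarrow> 'i \<Rightarrow> 'i) \<Rightarrow> bool" where
  "refines g0 g1 \<longleftrightarrow> (\<forall>p q s. g1 (g0 q p) s = g0 q (g1 p s))"

lemma refinesD:
  assumes "band g0" "band g1" "refines g0 g1"
  shows "g1 (g0 q p) s = g0 q (g1 p s)" "g0 p (g1 p s) = g1 p s" "g1 (g0 q p) p = g0 q p"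
  using assms unfolding refines_def by (metis bandD(1))+

lemma refines_flip: "refines g0 g1 \<Longrightarrow> refines (flip g1) (flip g0)"
  by (simp add: refines_def flip_def)

text \<open>The two maps act on disjoint parts of the multi-index.\<close>
lemma acts_right_commute:
  assumes band: "band g0" "band g1" and ref: "refines g0 g1"
    and S: "acts_right g1 S" and T: "acts_right (flip g0) T"
  shows "T (S Z) = S (T Z)"
proof -
  obtain b where b: "\<And>p q s. b (g1 s p) q = b p q" "\<And>Z p. S Z $ p = (\<Sum>q\<in>UNIV. b p q * Z $ g1 p q)"
    by (rule acts_rightE[OF S]) blast
  obtain a where a: "\<And>p q s. a (g0 p s) q = a p q" "\<And>Z p. T Z $ p = (\<Sum>q\<in>UNIV. a p q * Z $ g0 q p)"
    by (rule acts_rightE[OF T, unfolded flip_def]) blast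
  note r = refinesD[OF band ref]
  have b': "b (g0 q p) s = b p s" for p q s by (metis b(1) r(3))
  have a': "a (g1 p s) q = a p q" for p q s by (metis a(1) r(2))
  have "(\<Sum>q\<in>UNIV. \<Sum>s\<in>UNIV. a p q * (b p s * Z $ g0 q (g1 p s)))
      = (\<Sum>s\<in>UNIV. \<Sum>q\<in>UNIV. a p q * (b p s * Z $ g0 q (g1 p s)))" for p
    by (rule sum.swap)
  then show ?thesis
    by (simp add: cart_eq_iff a(2) b(2) a' b' r(1) sum_distrib_left mult.left_commute)
qed

text \<open>What acts to the right of \<open>g1\<close> also acts to the right of the earlier cut \<open>g0\<close>, where it is a
multiplication of the unfolding from the right; this forms linear combinations of columns.\<close>
lemma acts_right_colspace:
  assumes band: "band g0" "band g1" and ref: "refines g0 g1" and T: "acts_right g1 T"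
  shows "colspace g0 (T X) \<subseteq> colspace g0 X"
proof -
  obtain b where b: "\<And>p q s. b (g1 s p) q = b p q" "\<And>Z p. T Z $ p = (\<Sum>q\<in>UNIV. b p q * Z $ g1 p q)"
    by (rule acts_rightE[OF T]) blast
  note r = refinesD[OF band ref]
  have b': "b (g0 q p) s = b p s" for p q s by (metis b(1) r(3))
  have "column s (flattening g0 (T X)) = (\<Sum>q\<in>UNIV. b s q *\<^sub>R column (g1 s q) (flattening g0 X))" for s
    by (simp add: cart_eq_iff column_flattening b(2) b' r(1))
  moreover have "(\<Sum>q\<in>UNIV. b s q *\<^sub>R column (g1 s q) (flattening g0 X)) \<in> colspace g0 X" for s
    by (intro subspace_sum subspace_scale subspace_colspace column_mem_colspace)
  ultimately show ?thesis by (simp add: colspace_subset_iff[OF subspace_colspace])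
qed

text \<open>Conversely, if the columns of \<open>Z\<close> are combinations of columns of \<open>X\<close>, the coefficients form the kernel.\<close>
lemma colspace_subset_imp_acts_right:
  assumes band: "band g" and sub: "colspace g Z \<subseteq> colspace g X"
  obtains T where "acts_right g T" "Z = T X"
proof -
  \<comment> \<open>the preimage is chosen per column vector, so that the kernel depends on the right part only\<close>
  define f where "f v = (SOME w. v = flattening g X *v w)" for v
  have "\<exists>w. column s (flattening g Z) = flattening g X *v w" for s
    using sub column_mem_colspace[of s g Z] by (auto simp: colspace_def)
  then have f: "column s (flattening g Z) = flattening g X *v f (column s (flattening g Z))" for s
    unfolding f_def by (rule someI_ex)
  define b where "b p q = f (column p (flattening g Z)) $ q" for p q
  show ?thesis
  proof
    show "acts_right g (\<lambda>W. \<chi> p. \<Sum>q\<in>UNIV. b p q * W $ g p q)"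
      by (rule acts_rightI[where b = b]) (simp_all add: b_def column_band[OF band])
    have "Z $ p = (\<Sum>q\<in>UNIV. b p q * X $ g p q)" for p
    proof -
      have "Z $ p = column p (flattening g Z) $ p" by (simp add: column_flattening bandD[OF band])
      also have "\<dots> = (flattening g X *v f (column p (flattening g Z))) $ p" using f[of p] by simp
      finally show ?thesis by (simp add: flattening_mult b_def mult.commute)
    qed
    then show "Z = (\<chi> p. \<Sum>q\<in>UNIV. b p q * X $ g p q)" by (simp add: cart_eq_iff)
  qed
qed

section \<open>Projection of the columns of an unfolding\<close>

text \<open>The map \<open>P \<otimes> id\<close>, where \<open>P\<close> is the orthogonal projection onto the column space of the unfolding
of \<open>X\<close>.\<close>
definition colproj :: "('i \<Rightarrow> 'i \<Rightarrow> 'i) \<Rightarrow> real^'i::finite \<Rightarrow> real^'i \<Rightarrow> real^'i" where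
  "colproj g X Z = (\<chi> p. orth_proj (colspace g X) (column p (flattening g Z)) $ p)"

lemma column_colproj:
  assumes "band g"
  shows "column s (flattening g (colproj g X Z)) = orth_proj (colspace g X) (column s (flattening g Z))"
  by (simp add: cart_eq_iff column_flattening colproj_def column_band[OF assms]
      colspace_left[OF assms orth_proj(1)[OF subspace_colspace]])

lemma column_simps:
  "column s (flattening g (Z + W)) = column s (flattening g Z) + column s (flattening g W)"
  "column s (flattening g (Z - W)) = column s (flattening g Z) - column s (flattening g W)"
  "column s (flattening g (c *\<^sub>R Z)) = c *\<^sub>R column s (flattening g Z)"
  by (simp_all add: cart_eq_iff column_flattening)

text \<open>The kernel is the matrix of the projection onto the column space; it inherits its dependence on left parts
from the elements of that space.\<close>
lemma colproj_acts:
  assumes "band g"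
  shows "acts_right (flip g) (colproj g X)"
proof (rule acts_rightI[where b = "\<lambda>p q. orth_proj (colspace g X) (axis q 1) $ p"])
  show "orth_proj (colspace g X) (axis q 1) $ flip g s p = orth_proj (colspace g X) (axis q 1) $ p" for p q s
    by (simp add: flip_def colspace_left[OF assms orth_proj(1)[OF subspace_colspace]])
  fix Z p
  have "column p (flattening g Z) = (\<Sum>q\<in>UNIV. Z $ g q p *\<^sub>R axis q 1)"
    using basis_expansion[of "column p (flattening g Z)"]
    by (simp add: column_flattening scalar_mult_eq_scaleR)
  then show "colproj g X Z $ p = (\<Sum>q\<in>UNIV. orth_proj (colspace g X) (axis q 1) $ p * Z $ flip g p q)"
    by (simp add: colproj_def linear_sum[OF linear_orth_proj[OF subspace_colspace]]
        linear_cmul[OF linear_orth_proj[OF subspace_colspace]] flip_def mult.commute)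
qed

lemma colproj_colspace:
  assumes "band g"
  shows "colspace g (colproj g X Z) \<subseteq> colspace g X"
  unfolding colspace_subset_iff[OF subspace_colspace] column_colproj[OF assms]
  by (simp add: orth_proj(1)[OF subspace_colspace])

lemma colproj_id:
  assumes "band g" "colspace g Z \<subseteq> colspace g X"
  shows "colproj g X Z = Z"
  by (rule eq_by_columns[OF assms(1)])
    (use assms(2) in \<open>auto simp: column_colproj[OF assms(1)] colspace_subset_iff[OF subspace_colspace]
       intro: orth_proj_id[OF subspace_colspace]\<close>)

lemma colproj_sym:
  assumes "band g"
  shows "inner (colproj g X Z) W = inner Z (colproj g X W)"
proof -
  have "real CARD('a) * inner (colproj g X Z) W = real CARD('a) * inner Z (colproj g X W)"
    unfolding sum_inner_columns[OF assms, symmetric] column_colproj[OF assms]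
    by (simp add: orth_proj_sym[OF subspace_colspace])
  then show ?thesis by simp
qed

lemma norm_colproj_le:
  assumes "band g"
  shows "norm (colproj g X Z) \<le> norm Z" "norm (Z - colproj g X Z) \<le> norm Z"
  using norm_le_by_columns[OF assms, of 1 "colproj g X Z" Z] norm_le_by_columns[OF assms, of 1 "Z - colproj g X Z" Z]
  by (simp_all add: column_simps column_colproj[OF assms] norm_orth_proj_le[OF subspace_colspace])

section \<open>Singular values, ranks and gaps of unfoldings\<close>

lemma inner_flattening:
  "inner (flattening g X *v w) u = inner w (flattening (flip g) X *v u)"
proof -
  have "(\<Sum>p\<in>UNIV. \<Sum>q\<in>UNIV. u $ p * (w $ q * X $ g p q)) = (\<Sum>q\<in>UNIV. \<Sum>p\<in>UNIV. u $ p * (w $ q * X $ g p q))"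
    by (rule sum.swap)
  then show ?thesis
    by (simp add: inner_vec_def flattening_mult flip_def sum_distrib_left sum_distrib_right ac_simps)
qed

lemma flattening_mult_orthogonal:
  assumes "\<And>r. r \<in> colspace (flip g) X \<Longrightarrow> inner u r = 0"
  shows "flattening g X *v u = 0"
proof -
  have "inner (flattening g X *v u) v = 0" for v
    unfolding inner_flattening by (rule assms) (simp add: colspace_def)
  from this[of "flattening g X *v u"] show ?thesis by simp
qed

lemma colspace_by_rows:
  assumes "a \<in> colspace g X"
  obtains w where "w \<in> colspace (flip g) X" "a = flattening g X *v w"
proof -
  obtain v where v: "a = flattening g X *v v" using assms by (auto simp: colspace_def)
  define w where "w = orth_proj (colspace (flip g) X) v"
  have "flattening g X *v (v - w) = 0"
    unfolding w_def by (rule flattening_mult_orthogonal) (rule orth_proj(2)[OF subspace_colspace])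
  then have "a = flattening g X *v w" by (simp add: v matrix_vector_mult_diff_distrib)
  moreover have "w \<in> colspace (flip g) X" unfolding w_def by (rule orth_proj(1)[OF subspace_colspace])
  ultimately show ?thesis using that by blast
qed

text \<open>All nonzero singular values of the unfolding are at least \<open>s\<close>. The factor \<open>sqrt CARD('i)\<close> stems from
the repetition of rows and columns in \<open>flattening\<close>.\<close>
definition singular_bound :: "('i \<Rightarrow> 'i \<Rightarrow> 'i) \<Rightarrow> real^'i::finite \<Rightarrow> real \<Rightarrow> bool" where
  "singular_bound g X s \<longleftrightarrow>
     (\<forall>w\<in>colspace (flip g) X. s * sqrt CARD('i) * norm w \<le> norm (flattening g X *v w))"

lemma singular_bound_mono: "singular_bound g X s \<Longrightarrow> t \<le> s \<Longrightarrow> singular_bound g X t"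
  unfolding singular_bound_def by (meson order_trans mult_right_mono norm_ge_zero real_sqrt_ge_zero of_nat_0_le_iff)

text \<open>A matrix and its transpose have the same nonzero singular values. Without a singular value decomposition:
if \<open>w = X\<^sup>T u\<close> with \<open>u\<close> in the column space, then \<open>\<bar>w\<bar>\<^sup>2 = \<langle>X w, u\<rangle> \<le> \<bar>X w\<bar> \<bar>u\<bar>\<close>, and the bound
for the transpose controls \<open>\<bar>u\<bar>\<close> by \<open>\<bar>w\<bar>\<close>.\<close>
lemma singular_bound_flip:
  fixes X :: "real^'i::finite"
  assumes "singular_bound (flip g) X s" "s > 0"
  shows "singular_bound g X s"
  unfolding singular_bound_def
proof
  fix w assume "w \<in> colspace (flip g) X"
  then obtain u where u: "u \<in> colspace g X" "w = flattening (flip g) X *v u"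
    using colspace_by_rows[of w "flip g" X] by auto
  define c where "c = s * sqrt CARD('i)"
  have c: "c > 0" using assms(2) by (simp add: c_def)
  have bound: "c * norm u \<le> norm w"
    using assms(1) u by (auto simp: singular_bound_def c_def)
  have "norm w * norm w = inner (flattening g X *v w) u"
    unfolding inner_flattening u(2)[symmetric] by (simp add: power2_norm_eq_inner[symmetric] power2_eq_square)
  also have "\<dots> \<le> norm (flattening g X *v w) * norm u" by (rule norm_cauchy_schwarz)
  finally have "c * (norm w * norm w) \<le> c * (norm (flattening g X *v w) * norm u)" using c by simp
  also have "\<dots> = norm (flattening g X *v w) * (c * norm u)" by simp
  also have "\<dots> \<le> norm (flattening g X *v w) * norm w"
    by (rule mult_left_mono[OF bound]) simp
  finally have "(c * norm w) * norm w \<le> norm (flattening g X *v w) * norm w" by (simp add: ac_simps)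
  then show "s * sqrt CARD('i) * norm w \<le> norm (flattening g X *v w)"
    unfolding c_def by (cases "w = 0") simp_all
qed

text \<open>An unfolding is injective on its row space, hence bounded below there by compactness.\<close>
lemma singular_bound_exists:
  fixes X :: "real^'i::finite"
  shows "\<exists>s>0. singular_bound g X s"
proof -
  have "\<forall>w\<in>colspace (flip g) X. flattening g X *v w = 0 \<longrightarrow> w = 0"
  proof (intro ballI impI)
    fix w assume w: "w \<in> colspace (flip g) X" "flattening g X *v w = 0"
    then obtain u where u: "w = flattening (flip g) X *v u" by (auto simp: colspace_def)
    have "inner w w = inner (flattening g X *v w) u" unfolding inner_flattening u ..
    then show "w = 0" using w by simp
  qed
  from injective_imp_isometric[OF closed_subspace subspace_colspace _ this]
  obtain e where e: "e > 0" "\<And>w. w \<in> colspace (flip g) X \<Longrightarrow> e * norm w \<le> norm (flattening g X *v w)"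
    using subspace_colspace matrix_vector_mul_bounded_linear by blast
  show ?thesis
    by (rule exI[of _ "e / sqrt CARD('i)"]) (use e in \<open>simp add: singular_bound_def\<close>)
qed

text \<open>A perturbation smaller than the least singular value keeps the unfolding injective on the row space
of \<open>X\<close>.\<close>
lemma rank_lower_semicontinuous:
  fixes X Y :: "real^'i::finite"
  assumes band: "band g" and s: "singular_bound g X s" and near: "norm (X - Y) < s"
  shows "dim (colspace g X) \<le> dim (colspace g Y)"
proof -
  let ?W = "colspace (flip g) X"
  have 0: "w = 0" if "w \<in> ?W" "flattening g Y *v w = 0" for w
  proof (rule ccontr)
    assume "w \<noteq> 0"
    have "s * sqrt CARD('i) * norm w \<le> norm (flattening g X *v w)"
      using s that(1) by (auto simp: singular_bound_def)
    also have "flattening g X *v w = flattening g (X - Y) *v w"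
      using that(2) by (simp add: flattening_diff matrix_vector_mult_diff_rdistrib)
    also have "norm \<dots> \<le> sqrt CARD('i) * norm (X - Y) * norm w"
      by (rule norm_flattening_mult_le[OF band])
    finally have "s * (sqrt CARD('i) * norm w) \<le> norm (X - Y) * (sqrt CARD('i) * norm w)" by (simp add: ac_simps)
    then have "s \<le> norm (X - Y)" using \<open>w \<noteq> 0\<close> by simp
    then show False using near by simp
  qed
  have lin: "linear ((*v) (flattening g Y))" by simp
  have "inj_on ((*v) (flattening g Y)) (span ?W)"
  proof (rule inj_onI)
    fix x y assume "x \<in> span ?W" "y \<in> span ?W" "flattening g Y *v x = flattening g Y *v y"
    then have "x - y \<in> ?W" "flattening g Y *v (x - y) = 0"
      using span_eq_iff[THEN iffD2, OF subspace_colspace[of "flip g" X]]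
      by (auto simp: matrix_vector_mult_diff_distrib subspace_diff subspace_colspace)
    then show "x = y" using 0[of "x - y"] by simp
  qed
  then have "dim ?W = dim ((*v) (flattening g Y) ` ?W)" using dim_image_eq[OF lin] by metis
  also have "\<dots> \<le> dim (colspace g Y)" by (rule dim_subset) (auto simp: colspace_def)
  finally show ?thesis by (simp add: dim_colspace_flip)
qed

text \<open>An element \<open>a = X w\<close> of the column space, with \<open>w\<close> in the row space, is approximated by \<open>Y w\<close> with
error \<open>(X - Y) w\<close>, while the singular value bound controls \<open>w\<close> by \<open>a\<close>.\<close>
lemma colspace_gap:
  fixes X Y :: "real^'i::finite"
  assumes band: "band g" and s: "singular_bound g X s" "s > 0" and a: "a \<in> colspace g X"
  shows "norm (a - orth_proj (colspace g Y) a) \<le> norm (X - Y) / s * norm a"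
proof -
  obtain w where w: "w \<in> colspace (flip g) X" "a = flattening g X *v w"
    by (rule colspace_by_rows[OF a])
  have "norm (a - orth_proj (colspace g Y) a) \<le> norm (a - flattening g Y *v w)"
    by (rule norm_orth_compl_le_dist[OF subspace_colspace]) (simp add: colspace_def)
  also have "a - flattening g Y *v w = flattening g (X - Y) *v w"
    by (simp add: w flattening_diff matrix_vector_mult_diff_rdistrib)
  also have "norm \<dots> \<le> sqrt CARD('i) * norm (X - Y) * norm w"
    by (rule norm_flattening_mult_le[OF band])
  also have "\<dots> = norm (X - Y) / s * (s * sqrt CARD('i) * norm w)" using s(2) by simp
  also have "\<dots> \<le> norm (X - Y) / s * norm a"
    by (rule mult_left_mono) (use s w in \<open>auto simp: singular_bound_def\<close>)
  finally show ?thesis .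
qed

lemma colproj_gap:
  fixes X Y :: "real^'i::finite"
  assumes band: "band g" and s: "singular_bound g X s" "s > 0"
    and dim: "dim (colspace g X) = dim (colspace g Y)"
  shows "norm (colproj g X Z - colproj g Y Z) \<le> norm (X - Y) / s * norm Z"
    and "colspace g W \<subseteq> colspace g Y \<Longrightarrow> norm (W - colproj g X W) \<le> norm (X - Y) / s * norm W"
proof -
  have d0: "norm (X - Y) / s \<ge> 0" using s by simp
  note gapX = colspace_gap[OF band s, where Y = Y]
  have gapY: "norm (b - orth_proj (colspace g X) b) \<le> norm (X - Y) / s * norm b"
    if "b \<in> colspace g Y" for b
    by (rule gap_symmetric[OF subspace_colspace subspace_colspace dim gapX that])
  show "norm (colproj g X Z - colproj g Y Z) \<le> norm (X - Y) / s * norm Z"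
    by (rule norm_le_by_columns[OF band d0], unfold column_simps column_colproj[OF band])
      (rule norm_orth_proj_diff_le[OF subspace_colspace subspace_colspace gapX gapY d0])
  assume W: "colspace g W \<subseteq> colspace g Y"
  show "norm (W - colproj g X W) \<le> norm (X - Y) / s * norm W"
    by (rule norm_le_by_columns[OF band d0], unfold column_simps column_colproj[OF band])
      (use W gapY in \<open>auto simp: colspace_subset_iff[OF subspace_colspace]\<close>)
qed

section \<open>The normal projection of a chain of cuts\<close>

text \<open>The cuts behind the positions \<open>\<mu>\<close>. In terms of the column projections \<open>L\<^sub>\<mu>\<close> and the row projections
\<open>R\<^sub>\<mu>\<close> of \<open>X\<close>, with \<open>L\<^sub>0 = id\<close>, the normal projection at \<open>X\<close> will be
\<open>(L\<^sub>0 - L\<^sub>1) (id - R\<^sub>1) + \<dots> + (L\<^bsub>d-2\<^esub> - L\<^bsub>d-1\<^esub>) (id - R\<^bsub>d-1\<^esub>)\<close>.\<close>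
locale cut_family =
  fixes g :: "nat \<Rightarrow> 'i::finite \<Rightarrow> 'i \<Rightarrow> 'i" and d :: nat
  assumes band: "band (g \<mu>)" and refines: "\<mu> \<le> \<nu> \<Longrightarrow> refines (g \<mu>) (g \<nu>)"
begin

lemma bandf: "band (flip (g \<mu>))"
  by (rule band_flip[OF band])

definition left_proj :: "real^'i \<Rightarrow> nat \<Rightarrow> real^'i \<Rightarrow> real^'i" where
  "left_proj X \<mu> Z = (if \<mu> = 0 then Z else colproj (g \<mu>) X Z)"

definition right_proj :: "real^'i \<Rightarrow> nat \<Rightarrow> real^'i \<Rightarrow> real^'i" where
  "right_proj X \<mu> Z = colproj (flip (g \<mu>)) X Z"

definition left_step :: "real^'i \<Rightarrow> nat \<Rightarrow> real^'i \<Rightarrow> real^'i" where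
  "left_step X \<mu> Z = left_proj X (\<mu> - 1) Z - left_proj X \<mu> Z"

definition normal_part :: "real^'i \<Rightarrow> nat \<Rightarrow> real^'i \<Rightarrow> real^'i" where
  "normal_part X \<mu> Z = left_step X \<mu> (Z - right_proj X \<mu> Z)"

definition normal_proj :: "real^'i \<Rightarrow> real^'i \<Rightarrow> real^'i" where
  "normal_proj X Z = (\<Sum>\<mu>\<in>{1..<d}. normal_part X \<mu> Z)"

lemma acts_mono:
  assumes "\<mu> \<le> \<nu>"
  shows "acts_right (g \<nu>) T \<Longrightarrow> colspace (g \<mu>) (T X) \<subseteq> colspace (g \<mu>) X"
    and "acts_right (flip (g \<mu>)) T \<Longrightarrow> colspace (flip (g \<nu>)) (T X) \<subseteq> colspace (flip (g \<nu>)) X"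
  using acts_right_colspace[OF band band refines[OF assms]]
    acts_right_colspace[OF bandf bandf refines_flip[OF refines[OF assms]]] by blast+

lemma left_proj_acts: "acts_right (flip (g \<mu>)) (left_proj X \<mu>)"
  by (cases "\<mu> = 0") (simp_all add: left_proj_def[abs_def] colproj_acts[OF band] acts_right_id[OF bandf])

lemma right_proj_acts: "acts_right (g \<mu>) (right_proj X \<mu>)"
  using colproj_acts[OF bandf, of \<mu> X] by (simp add: right_proj_def[abs_def])

lemma compl_right_proj_acts: "acts_right (g \<mu>) (\<lambda>Z. Z - right_proj X \<mu> Z)"
  using acts_right_lincomb[OF acts_right_id[OF band] right_proj_acts, of \<mu> "-1"] by simp

lemma linear_left_proj: "linear (left_proj X \<mu>)" by (rule acts_right_linear[OF left_proj_acts])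
lemma linear_right_proj: "linear (right_proj X \<mu>)" by (rule acts_right_linear[OF right_proj_acts])

lemma linear_left_step: "linear (left_step X \<mu>)"
  unfolding left_step_def[abs_def] by (intro linear_compose_sub linear_left_proj)

lemma linear_normal_part: "linear (normal_part X \<mu>)"
  unfolding normal_part_def[abs_def]
  using linear_compose[OF linear_compose_sub[OF linear_id linear_right_proj] linear_left_step] by (simp add: o_def id_def)

lemma linear_normal_proj: "linear (normal_proj X)"
  unfolding normal_proj_def[abs_def] by (intro linear_compose_sum ballI linear_normal_part)

lemma left_proj_right_proj_commute: "\<mu> \<le> \<nu> \<Longrightarrow> left_proj X \<mu> (right_proj Y \<nu> Z) = right_proj Y \<nu> (left_proj X \<mu> Z)"
  by (rule acts_right_commute[OF band band refines right_proj_acts left_proj_acts])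

lemma left_step_right_proj_commute: "left_step X \<mu> (right_proj Y \<mu> Z) = right_proj Y \<mu> (left_step X \<mu> Z)"
  by (simp add: left_step_def left_proj_right_proj_commute linear_diff[OF linear_right_proj])

lemma left_proj_sym: "inner (left_proj X \<mu> Z) W = inner Z (left_proj X \<mu> W)"
  by (simp add: left_proj_def colproj_sym[OF band])

lemma right_proj_sym: "inner (right_proj X \<mu> Z) W = inner Z (right_proj X \<mu> W)"
  by (simp add: right_proj_def colproj_sym[OF bandf])

lemma left_step_sym: "inner (left_step X \<mu> Z) W = inner Z (left_step X \<mu> W)"
  by (simp add: left_step_def left_proj_sym inner_diff_left inner_diff_right)

lemma normal_part_sym: "inner (normal_part X \<mu> Z) W = inner Z (normal_part X \<mu> W)"
  by (simp add: normal_part_def left_step_sym linear_diff[OF linear_left_step] left_step_right_proj_commute right_proj_sym inner_diff_left inner_diff_right)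

lemma normal_proj_sym: "inner (normal_proj X Z) W = inner Z (normal_proj X W)"
  by (simp add: normal_proj_def inner_sum_left inner_sum_right normal_part_sym)

lemma left_proj_colspace: "\<mu> \<noteq> 0 \<Longrightarrow> colspace (g \<mu>) (left_proj X \<mu> Z) \<subseteq> colspace (g \<mu>) X"
  by (simp add: left_proj_def colproj_colspace[OF band])

lemma left_proj_colspace_mono:
  assumes "0 < \<mu>" "\<mu> \<le> \<nu>"
  shows "colspace (g \<mu>) (left_proj X \<nu> Z) \<subseteq> colspace (g \<mu>) X"
proof -
  obtain T where T: "acts_right (g \<nu>) T" "left_proj X \<nu> Z = T X"
    using colspace_subset_imp_acts_right[OF band left_proj_colspace] assms by (metis gr_implies_not0 order_less_le_trans)
  show ?thesis unfolding T(2) by (rule acts_mono(1)[OF assms(2) T(1)])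
qed

text \<open>The column spaces decrease along the chain of cuts: the columns at the later cut are combinations of columns
of \<open>X\<close>, which is a multiplication from the right at the earlier cut too.\<close>
lemma left_proj_nested: "\<mu> \<le> \<nu> \<Longrightarrow> left_proj X \<mu> (left_proj X \<nu> Z) = left_proj X \<nu> Z"
proof (cases "\<mu> = 0")
  case False
  assume "\<mu> \<le> \<nu>"
  with False show ?thesis
    using colproj_id[OF band left_proj_colspace_mono, of \<mu> \<nu>] by (simp add: left_proj_def[of _ \<mu>])
qed (simp add: left_proj_def)

lemma left_proj_nested':
  assumes "\<mu> \<le> \<nu>" shows "left_proj X \<nu> (left_proj X \<mu> Z) = left_proj X \<nu> Z"
proof -
  have "inner (left_proj X \<nu> (left_proj X \<mu> Z)) W = inner (left_proj X \<nu> Z) W" for W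
    by (simp add: left_proj_sym left_proj_nested[OF assms])
  then show ?thesis using vector_eq_rdot by blast
qed

lemma left_step_left_step:
  assumes "0 < \<mu>" "0 < \<nu>"
  shows "left_step X \<mu> (left_step X \<nu> Z) = (if \<mu> = \<nu> then left_step X \<mu> Z else 0)"
proof -
  consider "\<mu> = \<nu>" | "\<mu> \<le> \<nu> - 1" "\<mu> < \<nu>" | "\<nu> \<le> \<mu> - 1" "\<nu> < \<mu>" using assms by linarith
  then show ?thesis
    by cases (use assms in \<open>simp_all add: left_step_def linear_diff[OF linear_left_proj] left_proj_nested left_proj_nested'\<close>)
qed

lemma normal_part_alt: "normal_part X \<mu> Z = left_step X \<mu> Z - right_proj X \<mu> (left_step X \<mu> Z)"
  by (simp add: normal_part_def linear_diff[OF linear_left_step] left_step_right_proj_commute)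

lemma right_proj_idem: "right_proj X \<mu> (right_proj X \<mu> Z) = right_proj X \<mu> Z"
  unfolding right_proj_def by (rule colproj_id[OF bandf colproj_colspace[OF bandf]])

text \<open>The summands of the normal projection are orthogonal projections with orthogonal ranges, because the
differences \<open>L\<^sub>\<mu>\<^sub>-\<^sub>1 - L\<^sub>\<mu>\<close> of a decreasing chain of projections are.\<close>
lemma normal_part_normal_part:
  assumes "0 < \<mu>" "0 < \<nu>"
  shows "normal_part X \<mu> (normal_part X \<nu> Z) = (if \<mu> = \<nu> then normal_part X \<mu> Z else 0)"
proof -
  have "left_step X \<mu> (normal_part X \<nu> Z) = (if \<mu> = \<nu> then normal_part X \<mu> Z else 0)"
    unfolding normal_part_def by (simp add: left_step_left_step[OF assms])
  then show ?thesis
    unfolding normal_part_alt[of X \<mu> "normal_part X \<nu> Z"]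
    by (simp add: linear_0[OF linear_right_proj])
      (simp add: normal_part_alt linear_diff[OF linear_right_proj] right_proj_idem)
qed

lemma normal_part_normal_proj: "\<mu> \<in> {1..<d} \<Longrightarrow> normal_part X \<mu> (normal_proj X Z) = normal_part X \<mu> Z"
proof -
  assume \<mu>: "\<mu> \<in> {1..<d}"
  have "normal_part X \<mu> (normal_proj X Z) = (\<Sum>\<nu>\<in>{1..<d}. if \<mu> = \<nu> then normal_part X \<mu> Z else 0)"
    unfolding normal_proj_def linear_sum[OF linear_normal_part] by (rule sum.cong) (use \<mu> in \<open>simp_all add: normal_part_normal_part\<close>)
  then show ?thesis using \<mu> by simp
qed

lemma normal_proj_idem: "normal_proj X (normal_proj X Z) = normal_proj X Z"
  unfolding normal_proj_def[of X "normal_proj X Z"] by (simp add: normal_part_normal_proj) (simp add: normal_proj_def)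

lemma right_proj_self: "right_proj X \<mu> X = X"
  by (simp add: right_proj_def colproj_id[OF bandf])

lemma normal_proj_self: "normal_proj X X = 0"
  by (simp add: normal_proj_def normal_part_def right_proj_self linear_0[OF linear_left_step])

lemma norm_normal_proj: "(norm (normal_proj X Z))\<^sup>2 = (\<Sum>\<mu>\<in>{1..<d}. (norm (normal_part X \<mu> Z))\<^sup>2)"
proof -
  have "(norm (normal_proj X Z))\<^sup>2 = inner (normal_proj X Z) Z"
    using normal_proj_sym[of X Z "normal_proj X Z"] by (simp add: power2_norm_eq_inner normal_proj_idem inner_commute)
  also have "\<dots> = (\<Sum>\<mu>\<in>{1..<d}. inner (normal_part X \<mu> (normal_part X \<mu> Z)) Z)"
    unfolding normal_proj_def inner_sum_left by (rule sum.cong) (simp_all add: normal_part_normal_part)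
  also have "\<dots> = (\<Sum>\<mu>\<in>{1..<d}. (norm (normal_part X \<mu> Z))\<^sup>2)"
    by (simp add: normal_part_sym power2_norm_eq_inner)
  finally show ?thesis .
qed

lemma norm_left_proj_le: "norm (left_proj X \<mu> Z) \<le> norm Z" "norm (Z - left_proj X \<mu> Z) \<le> norm Z"
  by (simp_all add: left_proj_def norm_colproj_le[OF band])

lemma norm_left_step_le:
  assumes "0 < \<mu>"
  shows "norm (left_step X \<mu> Z) \<le> norm (Z - left_proj X \<mu> Z)"
proof -
  have "left_step X \<mu> Z = left_proj X (\<mu> - 1) (Z - left_proj X \<mu> Z)"
    by (simp add: left_step_def linear_diff[OF linear_left_proj] left_proj_nested)
  then show ?thesis using norm_left_proj_le(1) by metis
qed

definition singular_bounds :: "real^'i \<Rightarrow> real \<Rightarrow> bool" where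
  "singular_bounds X s \<longleftrightarrow> s > 0 \<and> (\<forall>\<mu>\<in>{1..<d}. singular_bound (g \<mu>) X s)"

definition same_ranks :: "real^'i \<Rightarrow> real^'i \<Rightarrow> bool" where
  "same_ranks X Y \<longleftrightarrow> (\<forall>\<mu>\<in>{1..<d}. dim (colspace (g \<mu>) X) = dim (colspace (g \<mu>) Y))"

lemma singular_bounds_exists: "\<exists>s. singular_bounds X s"
proof -
  have "\<exists>s>0. \<forall>\<mu>\<in>M. singular_bound (g \<mu>) X s" if "finite M" for M
    using that
  proof induction
    case empty
    show ?case by (auto intro: exI[of _ 1])
  next
    case (insert \<mu> M)
    then obtain s where s: "s > 0" "\<forall>\<mu>\<in>M. singular_bound (g \<mu>) X s" by blast
    obtain r where r: "r > 0" "singular_bound (g \<mu>) X r" using singular_bound_exists by blast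
    have "singular_bound (g \<nu>) X (min s r)" if "\<nu> \<in> insert \<mu> M" for \<nu>
      using that s(2) singular_bound_mono[OF r(2) min.cobounded2] singular_bound_mono[OF _ min.cobounded1] by blast
    then show ?case using s(1) r(1) by (intro exI[of _ "min s r"]) simp
  qed
  from this[of "{1..<d}"] show ?thesis unfolding singular_bounds_def by simp
qed

lemma rank_le_near:
  assumes "singular_bounds X s" "norm (X - Y) < s" "\<mu> \<in> {1..<d}"
  shows "dim (colspace (g \<mu>) X) \<le> dim (colspace (g \<mu>) Y)"
  using assms by (auto simp: singular_bounds_def intro: rank_lower_semicontinuous[OF band])

text \<open>With \<open>V = (id - R\<^sub>\<mu>) Y\<close> one factor \<open>\<bar>X - Y\<bar>\<close> comes from \<open>V = (id - R\<^sub>\<mu>) (Y - X)\<close>, as \<open>R\<^sub>\<mu>\<close> fixes \<open>X\<close>. The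
other factor comes from \<open>id - L\<^sub>\<mu>\<close>: the map \<open>id - R\<^sub>\<mu>\<close> acts on the right, so \<open>V\<close> has its columns in the column
space of \<open>Y\<close>, whose gap to that of \<open>X\<close> is at most \<open>\<bar>X - Y\<bar> / s\<close>.\<close>
lemma norm_normal_part_le:
  assumes s: "singular_bounds X s" and ranks: "same_ranks X Y" and \<mu>: "\<mu> \<in> {1..<d}"
  shows "norm (normal_part X \<mu> Y) \<le> norm (X - Y) / s * norm (X - Y)"
proof -
  have s': "singular_bound (g \<mu>) X s" "s > 0" and dim: "dim (colspace (g \<mu>) X) = dim (colspace (g \<mu>) Y)"
    using s \<mu> ranks by (auto simp: singular_bounds_def same_ranks_def)
  define V where "V = Y - right_proj X \<mu> Y"
  have "V = (Y - X) - right_proj X \<mu> (Y - X)" by (simp add: V_def linear_diff[OF linear_right_proj] right_proj_self)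
  then have V: "norm V \<le> norm (X - Y)"
    using norm_colproj_le(2)[OF bandf, of "Y - X" \<mu> X] by (simp add: right_proj_def norm_minus_commute)
  have "norm (normal_part X \<mu> Y) \<le> norm (V - colproj (g \<mu>) X V)"
    using norm_left_step_le[of \<mu> X V] \<mu> by (simp add: normal_part_def V_def left_proj_def)
  also have "\<dots> \<le> norm (X - Y) / s * norm V"
    by (rule colproj_gap(2)[OF band s' dim]) (unfold V_def, rule acts_mono(1)[OF order_refl compl_right_proj_acts])
  also have "\<dots> \<le> norm (X - Y) / s * norm (X - Y)"
    by (rule mult_left_mono[OF V]) (use s' in simp)
  finally show ?thesis .
qed

text \<open>The normal projection annihilates \<open>X\<close>, and the \<open>d - 1\<close> normal parts of \<open>Y\<close> add up by Pythagoras.\<close>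
lemma norm_normal_proj_le:
  assumes s: "singular_bounds X s" and ranks: "same_ranks X Y"
  shows "norm (normal_proj X (X - Y)) \<le> sqrt (real (d - 1)) / s * (norm (X - Y))\<^sup>2"
proof -
  have s0: "s > 0" using s by (simp add: singular_bounds_def)
  have "(norm (normal_proj X Y))\<^sup>2 \<le> (\<Sum>\<mu>\<in>{1..<d}. (norm (X - Y) / s * norm (X - Y))\<^sup>2)"
    unfolding norm_normal_proj by (intro sum_mono power_mono norm_normal_part_le[OF s ranks]) auto
  also have "\<dots> = (sqrt (real (d - 1)) / s * (norm (X - Y))\<^sup>2)\<^sup>2"
    by (simp add: power_mult_distrib power_divide power2_eq_square)
  finally have "norm (normal_proj X Y) \<le> sqrt (real (d - 1)) / s * (norm (X - Y))\<^sup>2"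
    by (rule power2_le_imp_le) (use s0 in simp)
  moreover have "normal_proj X (X - Y) = - normal_proj X Y" by (simp add: linear_diff[OF linear_normal_proj] normal_proj_self)
  ultimately show ?thesis by simp
qed

text \<open>Each of the \<open>d - 1\<close> summands is a product of two factors built from three projections, each of which moves
by at most \<open>\<delta> = \<bar>X - Y\<bar> / s\<close>, and all other factors are contractions.\<close>
lemma norm_normal_proj_diff_le:
  assumes s: "singular_bounds X s" and ranks: "same_ranks X Y"
  shows "norm (normal_proj X Z - normal_proj Y Z) \<le> 3 * real (d - 1) * (norm (X - Y) / s) * norm Z"
proof -
  define \<delta> where "\<delta> = norm (X - Y) / s"
  have s0: "s > 0" using s by (simp add: singular_bounds_def)
  then have \<delta>0: "\<delta> \<ge> 0" by (simp add: \<delta>_def)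
  have gapL: "norm (left_proj X \<mu> W - left_proj Y \<mu> W) \<le> \<delta> * norm W" if "\<mu> < d" for \<mu> W
  proof (cases "\<mu> = 0")
    case True then show ?thesis using \<delta>0 by (simp add: left_proj_def)
  next
    case False
    then have "singular_bound (g \<mu>) X s" "dim (colspace (g \<mu>) X) = dim (colspace (g \<mu>) Y)"
      using s ranks that unfolding singular_bounds_def same_ranks_def by auto
    from colproj_gap(1)[OF band this(1) s0 this(2), of W] False show ?thesis by (simp add: left_proj_def \<delta>_def)
  qed
  have gapR: "norm (right_proj X \<mu> W - right_proj Y \<mu> W) \<le> \<delta> * norm W" if "\<mu> \<in> {1..<d}" for \<mu> W
  proof -
    have "singular_bound (flip (g \<mu>)) X s" "dim (colspace (flip (g \<mu>)) X) = dim (colspace (flip (g \<mu>)) Y)"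
      using s ranks that singular_bound_flip[of "flip (g \<mu>)" X s]
      unfolding singular_bounds_def same_ranks_def dim_colspace_flip flip_flip by auto
    from colproj_gap(1)[OF bandf this(1) s0 this(2), of W] show ?thesis by (simp add: right_proj_def \<delta>_def)
  qed
  have "norm (normal_part X \<mu> Z - normal_part Y \<mu> Z) \<le> 3 * \<delta> * norm Z" if \<mu>: "\<mu> \<in> {1..<d}" for \<mu>
  proof -
    define V where "V = Z - right_proj X \<mu> Z"
    have V: "norm V \<le> norm Z" unfolding V_def right_proj_def by (rule norm_colproj_le(2)[OF bandf])
    have split: "normal_part X \<mu> Z - normal_part Y \<mu> Z
        = (left_proj X (\<mu> - 1) V - left_proj Y (\<mu> - 1) V) - (left_proj X \<mu> V - left_proj Y \<mu> V) - left_step Y \<mu> (right_proj X \<mu> Z - right_proj Y \<mu> Z)"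
    proof -
      \<comment> \<open>telescoping: first exchange the left factor, then the right one\<close>
      have "Z - right_proj Y \<mu> Z = V + (right_proj X \<mu> Z - right_proj Y \<mu> Z)" by (simp add: V_def)
      then have "normal_part Y \<mu> Z = left_step Y \<mu> (V + (right_proj X \<mu> Z - right_proj Y \<mu> Z))" by (simp only: normal_part_def)
      also have "\<dots> = left_step Y \<mu> V + left_step Y \<mu> (right_proj X \<mu> Z - right_proj Y \<mu> Z)" by (rule linear_add[OF linear_left_step])
      finally have "normal_part Y \<mu> Z = left_step Y \<mu> V + left_step Y \<mu> (right_proj X \<mu> Z - right_proj Y \<mu> Z)" .
      moreover have "normal_part X \<mu> Z = left_step X \<mu> V" by (simp add: normal_part_def V_def)
      ultimately have "normal_part X \<mu> Z - normal_part Y \<mu> Z = left_step X \<mu> V - left_step Y \<mu> V - left_step Y \<mu> (right_proj X \<mu> Z - right_proj Y \<mu> Z)"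
        by (simp only: diff_diff_eq)
      then show ?thesis by (simp only: left_step_def[of X \<mu> V] left_step_def[of Y \<mu> V]) simp
    qed
    have "norm (normal_part X \<mu> Z - normal_part Y \<mu> Z) \<le> norm (left_proj X (\<mu> - 1) V - left_proj Y (\<mu> - 1) V) + norm (left_proj X \<mu> V - left_proj Y \<mu> V)
        + norm (left_step Y \<mu> (right_proj X \<mu> Z - right_proj Y \<mu> Z))"
      unfolding split by (rule order_trans[OF norm_triangle_ineq4 add_right_mono[OF norm_triangle_ineq4]])
    also have "\<dots> \<le> \<delta> * norm V + \<delta> * norm V + \<delta> * norm Z"
    proof -
      have "norm (left_step Y \<mu> (right_proj X \<mu> Z - right_proj Y \<mu> Z)) \<le> norm (right_proj X \<mu> Z - right_proj Y \<mu> Z)"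
        using order_trans[OF norm_left_step_le[of \<mu> Y "right_proj X \<mu> Z - right_proj Y \<mu> Z"] norm_left_proj_le(2)[of "right_proj X \<mu> Z - right_proj Y \<mu> Z" Y \<mu>]] \<mu>
        by simp
      also have "\<dots> \<le> \<delta> * norm Z" by (rule gapR[OF \<mu>])
      finally have "norm (left_step Y \<mu> (right_proj X \<mu> Z - right_proj Y \<mu> Z)) \<le> \<delta> * norm Z" .
      moreover have "\<mu> - 1 < d" "\<mu> < d" using \<mu> by auto
      ultimately show ?thesis using gapL[of "\<mu> - 1" V] gapL[of \<mu> V] by linarith
    qed
    also have "\<dots> \<le> 3 * \<delta> * norm Z"
      using mult_left_mono[OF V \<delta>0] by linarith
    finally show ?thesis .
  qed
  then have "norm (normal_proj X Z - normal_proj Y Z) \<le> (\<Sum>\<mu>\<in>{1..<d}. 3 * \<delta> * norm Z)"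
    unfolding normal_proj_def sum_subtractf[symmetric] by (intro sum_norm_le) auto
  also have "\<dots> = 3 * real (d - 1) * \<delta> * norm Z" by simp
  finally show ?thesis unfolding \<delta>_def .
qed

end

section \<open>TT rank and ranks of unfoldings\<close>

definition glue :: "('i \<Rightarrow> nat \<Rightarrow> nat) \<Rightarrow> nat \<Rightarrow> 'i \<Rightarrow> 'i \<Rightarrow> 'i" where
  "glue ix \<mu> p q = inv_into UNIV ix (\<lambda>i. if i \<le> \<mu> then ix p i else ix q i)"

lemma ix_glue:
  assumes "bij_betw ix UNIV (multi_indices d N)"
  shows "ix (glue ix \<mu> p q) = (\<lambda>i. if i \<le> \<mu> then ix p i else ix q i)"
proof -
  have "ix r \<in> multi_indices d N" for r using assms by (auto simp: bij_betw_def)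
  then have "(\<lambda>i. if i \<le> \<mu> then ix p i else ix q i) \<in> multi_indices d N"
    unfolding multi_indices_def PiE_def Pi_def extensional_def by auto
  then show ?thesis
    unfolding glue_def using bij_betw_inv_into_right[OF assms] by metis
qed

lemma ix_eqD: "bij_betw ix UNIV M \<Longrightarrow> ix p = ix q \<Longrightarrow> p = q"
  by (auto simp: bij_betw_def inj_def)

lemma cut_family_glue:
  assumes "bij_betw ix UNIV (multi_indices d N)"
  shows "cut_family (glue ix)"
  by unfold_locales
    (auto simp: band_def refines_def ix_glue[OF assms] fun_eq_iff intro!: ix_eqD[OF assms])

lemma glue_0:
  assumes "bij_betw ix UNIV (multi_indices d N)"
  shows "glue ix 0 p q = q"
proof (rule ix_eqD[OF assms])
  have "ix r \<in> multi_indices d N" for r using assms by (auto simp: bij_betw_def)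
  then have "ix r 0 = undefined" for r
    unfolding multi_indices_def by (rule PiE_arb) simp
  then show "ix (glue ix 0 p q) = ix q" unfolding ix_glue[OF assms] by auto
qed

lemma glue_d:
  assumes "bij_betw ix UNIV (multi_indices d N)"
  shows "glue ix d p q = p"
proof (rule ix_eqD[OF assms])
  have "ix r \<in> multi_indices d N" for r using assms by (auto simp: bij_betw_def)
  then have "ix r i = undefined" if "i > d" for r i
    unfolding multi_indices_def by (rule PiE_arb) (use that in simp)
  then show "ix (glue ix d p q) = ix p" unfolding ix_glue[OF assms] by auto
qed

lemma ix_range:
  assumes "bij_betw ix UNIV (multi_indices d N)" "\<mu> \<in> {1..d}"
  shows "ix p \<mu> \<in> {1..N \<mu>}"
proof -
  have "ix p \<in> multi_indices d N" using assms(1) by (auto simp: bij_betw_def)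
  then show ?thesis using assms(2) unfolding multi_indices_def by (rule PiE_mem)
qed

lemma index_mult_sum:
  assumes "A \<in> carrier_mat 1 n" "B \<in> carrier_mat n m" "l < m"
  shows "(A * B) $$ (0, l) = (\<Sum>a<n. A $$ (0, a) * B $$ (a, l))"
  using assms by (simp add: scalar_prod_def lessThan_atLeast0)

text \<open>The product \<open>G\<^bsub>\<mu>+1\<^esub> \<cdots> G\<^bsub>\<mu>+m\<^esub>\<close>, with \<open>r\<close> the number of rows of the empty product.\<close>
primrec tail_prod :: "(nat \<Rightarrow> nat \<Rightarrow> real mat) \<Rightarrow> (nat \<Rightarrow> nat) \<Rightarrow> nat \<Rightarrow> nat \<Rightarrow> nat \<Rightarrow> real mat" where
  "tail_prod G i r \<mu> 0 = 1\<^sub>m r"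
| "tail_prod G i r \<mu> (Suc m) = tail_prod G i r \<mu> m * G (Suc (\<mu> + m)) (i (Suc (\<mu> + m)))"

lemma core_prod_carrier:
  assumes "k 0 = 1" "\<And>\<mu>. \<mu> \<in> {1..d} \<Longrightarrow> G \<mu> (i \<mu>) \<in> carrier_mat (k (\<mu> - 1)) (k \<mu>)" "n \<le> d"
  shows "core_prod G i n \<in> carrier_mat 1 (k n)"
  using assms(3)
proof (induction n)
  case 0 then show ?case using assms(1) by simp
next
  case (Suc n)
  have "G (Suc n) (i (Suc n)) \<in> carrier_mat (k n) (k (Suc n))" using assms(2)[of "Suc n"] Suc.prems by simp
  then show ?case using Suc by (simp add: mult_carrier_mat[of _ 1 "k n"])
qed

lemma tail_prod_carrier:
  assumes "\<And>\<mu>. \<mu> \<in> {1..d} \<Longrightarrow> G \<mu> (i \<mu>) \<in> carrier_mat (k (\<mu> - 1)) (k \<mu>)" "\<mu> + m \<le> d"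
  shows "tail_prod G i (k \<mu>) \<mu> m \<in> carrier_mat (k \<mu>) (k (\<mu> + m))"
  using assms(2)
proof (induction m)
  case 0 then show ?case by simp
next
  case (Suc m)
  have "G (Suc (\<mu> + m)) (i (Suc (\<mu> + m))) \<in> carrier_mat (k (\<mu> + m)) (k (Suc (\<mu> + m)))"
    using assms(1)[of "Suc (\<mu> + m)"] Suc.prems by simp
  then show ?case using Suc by (simp add: mult_carrier_mat[of _ "k \<mu>" "k (\<mu> + m)"])
qed

lemma core_prod_split:
  assumes "k 0 = 1" and G: "\<And>\<mu>. \<mu> \<in> {1..d} \<Longrightarrow> G \<mu> (i \<mu>) \<in> carrier_mat (k (\<mu> - 1)) (k \<mu>)" and "\<mu> + m \<le> d"
  shows "core_prod G i (\<mu> + m) = core_prod G i \<mu> * tail_prod G i (k \<mu>) \<mu> m"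
  using assms(3)
proof (induction m)
  case 0
  then have "core_prod G i \<mu> \<in> carrier_mat 1 (k \<mu>)" using core_prod_carrier[of k d G i \<mu>] assms(1,2) by simp
  then show ?case by simp
next
  case (Suc m)
  have a: "core_prod G i \<mu> \<in> carrier_mat 1 (k \<mu>)"
    by (rule core_prod_carrier[where d = d, of k G i, OF assms(1) G]) (use Suc.prems in auto)
  have b: "tail_prod G i (k \<mu>) \<mu> m \<in> carrier_mat (k \<mu>) (k (\<mu> + m))"
    by (rule tail_prod_carrier[where d = d, of G i k, OF G]) (use Suc.prems in auto)
  have c: "G (Suc (\<mu> + m)) (i (Suc (\<mu> + m))) \<in> carrier_mat (k (\<mu> + m)) (k (Suc (\<mu> + m)))"
    using G[of "Suc (\<mu> + m)"] Suc.prems by simp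
  show ?case using Suc assoc_mult_mat[OF a b c] by simp
qed

lemma core_prod_cong: "(\<And>l. 1 \<le> l \<Longrightarrow> l \<le> n \<Longrightarrow> i l = j l) \<Longrightarrow> core_prod G i n = core_prod G j n"
  by (induction n) auto

lemma tail_prod_cong: "(\<And>l. \<mu> < l \<Longrightarrow> i l = j l) \<Longrightarrow> tail_prod G i r \<mu> m = tail_prod G j r \<mu> m"
  by (induction m) auto

text \<open>Splitting the product of the cores at \<open>\<mu>\<close> factors the unfolding through a space of dimension \<open>k \<mu>\<close>.\<close>
lemma rank_le_of_tt_repr:
  assumes bij: "bij_betw ix UNIV (multi_indices d N)"
    and repr: "has_tt_repr d N ix k X" and \<mu>: "\<mu> \<le> d"
  shows "dim (colspace (glue ix \<mu>) X) \<le> k \<mu>"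
proof -
  obtain G where k: "k 0 = 1" "k d = 1"
    and G: "\<And>\<mu> j. \<mu> \<in> {1..d} \<Longrightarrow> j \<in> {1..N \<mu>} \<Longrightarrow> G \<mu> j \<in> carrier_mat (k (\<mu> - 1)) (k \<mu>)"
    and X: "\<And>p. X $ p = core_prod G (ix p) d $$ (0, 0)"
    using repr unfolding has_tt_repr_def by blast
  have G': "\<And>\<mu>. \<mu> \<in> {1..d} \<Longrightarrow> G \<mu> (ix p \<mu>) \<in> carrier_mat (k (\<mu> - 1)) (k \<mu>)" for p
    using G ix_range[OF bij] by blast
  define u where "u j = (\<chi> p. core_prod G (ix p) \<mu> $$ (0, j))" for j
  define t where "t s j = tail_prod G (ix s) (k \<mu>) \<mu> (d - \<mu>) $$ (j, 0)" for s j
  have "X $ glue ix \<mu> p s = (\<Sum>j<k \<mu>. u j $ p * t s j)" for p s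
  proof -
    let ?q = "glue ix \<mu> p s"
    have "X $ ?q = (core_prod G (ix ?q) \<mu> * tail_prod G (ix ?q) (k \<mu>) \<mu> (d - \<mu>)) $$ (0, 0)"
      using core_prod_split[of k d G "ix ?q" \<mu> "d - \<mu>", OF k(1) G'] \<mu> X by simp
    also have "\<dots> = (\<Sum>j<k \<mu>. core_prod G (ix ?q) \<mu> $$ (0, j) * tail_prod G (ix ?q) (k \<mu>) \<mu> (d - \<mu>) $$ (j, 0))"
      using core_prod_carrier[of k d G "ix ?q" \<mu>, OF k(1) G' \<mu>]
        tail_prod_carrier[of d G "ix ?q" k \<mu> "d - \<mu>", OF G'] \<mu> k(2)
      by (intro index_mult_sum[where m = 1]) auto
    also have "core_prod G (ix ?q) \<mu> = core_prod G (ix p) \<mu>"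
      by (rule core_prod_cong) (simp add: ix_glue[OF bij])
    also have "tail_prod G (ix ?q) (k \<mu>) \<mu> (d - \<mu>) = tail_prod G (ix s) (k \<mu>) \<mu> (d - \<mu>)"
      by (rule tail_prod_cong) (simp add: ix_glue[OF bij])
    finally show ?thesis by (simp add: u_def t_def)
  qed
  then have "column s (flattening (glue ix \<mu>) X) = (\<Sum>j<k \<mu>. t s j *\<^sub>R u j)" for s
    by (simp add: cart_eq_iff column_flattening mult.commute)
  then have "colspace (glue ix \<mu>) X \<subseteq> span (u ` {..<k \<mu>})"
    by (auto simp: colspace_subset_iff[OF subspace_span] intro!: span_sum span_scale intro: span_base)
  then have "dim (colspace (glue ix \<mu>) X) \<le> card (u ` {..<k \<mu>})" by (intro dim_le_card) auto
  also have "\<dots> \<le> k \<mu>" using card_image_le[of "{..<k \<mu>}" u] by simp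
  finally show ?thesis .
qed

lemma span_image_sum:
  fixes f :: "nat \<Rightarrow> 'a::real_vector"
  assumes "x \<in> span (f ` {..<n})"
  shows "\<exists>c. x = (\<Sum>j<n. c j *\<^sub>R f j)"
  using assms
proof (induction rule: span_induct_alt)
  case base
  show ?case by (rule exI[of _ "\<lambda>_. 0"]) simp
next
  case (step a y z)
  then obtain i c where i: "i < n" "y = f i" and c: "z = (\<Sum>j<n. c j *\<^sub>R f j)" by blast
  have "(\<Sum>j<n. ((if j = i then a else 0) + c j) *\<^sub>R f j) = (\<Sum>j<n. (if j = i then a *\<^sub>R f j else 0)) + z"
    unfolding c sum.distrib[symmetric] by (rule sum.cong) (auto simp: algebra_simps)
  then have "a *\<^sub>R y + z = (\<Sum>j<n. ((if j = i then a else 0) + c j) *\<^sub>R f j)"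
    using i by simp
  then show ?case by (rule exI[of _ "\<lambda>j. (if j = i then a else 0) + c j"])
qed

lemma subspace_spanning_family:
  fixes S :: "'a::euclidean_space set"
  assumes "subspace S" "dim S \<le> n"
  shows "\<exists>u::nat \<Rightarrow> 'a. S \<subseteq> span (u ` {..<n}) \<and> (\<forall>j. u j \<in> S)"
proof -
  obtain B where B: "B \<subseteq> S" "independent B" "S \<subseteq> span B" "card B = dim S" by (rule basis_exists)
  have fin: "finite B" using B(2) by (rule independent_imp_finite)
  obtain f where f: "bij_betw f {0..<card B} B" using ex_bij_betw_nat_finite[OF fin] by blast
  then have fB: "f ` {0..<card B} = B" by (simp add: bij_betw_def)
  define u where "u j = (if j < card B then f j else 0)" for j
  have "B \<subseteq> u ` {..<n}"
  proof
    fix b assume "b \<in> B"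
    then obtain j where "j < card B" "b = f j" using fB by (metis atLeastLessThan_iff imageE)
    then show "b \<in> u ` {..<n}" using B(4) assms(2) by (intro image_eqI[of _ _ j]) (auto simp: u_def)
  qed
  then have "S \<subseteq> span (u ` {..<n})" using B(3) span_mono by blast
  moreover have "u j \<in> S" for j
    using fB B(1) subspace_0[OF assms(1)] imageI[of j "{0..<card B}" f] by (auto simp: u_def)
  ultimately show ?thesis by blast
qed

text \<open>Choose spanning families \<open>v \<mu>\<close> of the column spaces, with the constant tensor 1 at \<open>\<mu> = 0\<close> and \<open>X\<close> itself at
\<open>\<mu> = d\<close>. Fixing the index at position \<open>\<mu> + 1\<close> in an element of the column space at \<open>\<mu> + 1\<close> gives an
element of the column space at \<open>\<mu>\<close>; its coefficients with respect to \<open>v \<mu>\<close> are the entries of the core.\<close>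
lemma tt_repr_of_ranks:
  fixes X :: "real^'i::finite"
  assumes d: "d \<ge> 1" and bij: "bij_betw ix UNIV (multi_indices d N)" and k: "k 0 = 1" "k d = 1"
    and ranks: "\<And>\<mu>. \<mu> \<in> {1..<d} \<Longrightarrow> dim (colspace (glue ix \<mu>) X) \<le> k \<mu>"
  shows "has_tt_repr d N ix k X"
proof -
  interpret cut_family "glue ix" d by (rule cut_family_glue[OF bij])
  define u where "u \<mu> = (SOME u. colspace (glue ix \<mu>) X \<subseteq> span (u ` {..<k \<mu>}) \<and>
    (\<forall>j::nat. u j \<in> colspace (glue ix \<mu>) X))" for \<mu>
  have u: "colspace (glue ix \<mu>) X \<subseteq> span (u \<mu> ` {..<k \<mu>}) \<and> (\<forall>j. u \<mu> j \<in> colspace (glue ix \<mu>) X)"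
    if "\<mu> \<in> {1..<d}" for \<mu>
    using someI_ex[OF subspace_spanning_family[OF subspace_colspace ranks[OF that]]] unfolding u_def .
  define v where "v \<mu> = (if \<mu> = 0 then (\<lambda>_. \<chi> p. 1) else if \<mu> = d then (\<lambda>_. X) else u \<mu>)" for \<mu>
  have v_col: "v \<mu> l \<in> colspace (glue ix \<mu>) X" if "1 \<le> \<mu>" "\<mu> \<le> d" for \<mu> l
  proof (cases "\<mu> = d")
    case True
    have "column undefined (flattening (glue ix d) X) = X"
      by (simp add: cart_eq_iff column_flattening glue_d[OF bij])
    then show ?thesis using True d column_mem_colspace[of undefined "glue ix d" X] by (simp add: v_def)
  next
    case False
    then show ?thesis using that u[of \<mu>] by (simp add: v_def)
  qed
  have slice: "column r (flattening (glue ix \<mu>) (v (Suc \<mu>) l)) \<in> span (v \<mu> ` {..<k \<mu>})" if \<mu>: "\<mu> < d" for \<mu> l r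
  proof (cases "\<mu> = 0")
    case True
    have "column r (flattening (glue ix 0) (v (Suc 0) l)) = v (Suc 0) l $ r *\<^sub>R v 0 0"
      by (simp add: cart_eq_iff column_flattening glue_0[OF bij] v_def)
    then show ?thesis using True k(1) by (simp add: span_base span_scale)
  next
    case False
    have "column s (flattening (glue ix (Suc \<mu>)) X) \<in> {W. column r (flattening (glue ix \<mu>) W) \<in> colspace (glue ix \<mu>) X}" for s
    proof -
      have "column r (flattening (glue ix \<mu>) (column s (flattening (glue ix (Suc \<mu>)) X)))
          = column (glue ix (Suc \<mu>) r s) (flattening (glue ix \<mu>) X)"
        using refines[of \<mu> "Suc \<mu>"] by (simp add: cart_eq_iff column_flattening refines_def)
      then show ?thesis using column_mem_colspace by simp
    qed
    moreover have "subspace {W. column r (flattening (glue ix \<mu>) W) \<in> colspace (glue ix \<mu>) X}"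
      by (rule linear_subspace_vimage[OF _ subspace_colspace, unfolded vimage_def])
        (rule linearI, simp_all add: column_simps)
    ultimately have "colspace (glue ix (Suc \<mu>)) X \<subseteq> {W. column r (flattening (glue ix \<mu>) W) \<in> colspace (glue ix \<mu>) X}"
      by (simp add: colspace_subset_iff)
    with v_col[of "Suc \<mu>" l] \<mu>
    have "column r (flattening (glue ix \<mu>) (v (Suc \<mu>) l)) \<in> colspace (glue ix \<mu>) X" by auto
    also have "\<dots> \<subseteq> span (v \<mu> ` {..<k \<mu>})" using u[of \<mu>] False \<mu> by (simp add: v_def)
    finally show ?thesis .
  qed
  define c where "c \<mu> l r = (SOME c. column r (flattening (glue ix \<mu>) (v (Suc \<mu>) l)) = (\<Sum>a<k \<mu>. c a *\<^sub>R v \<mu> a))"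
    for \<mu> l r
  have c: "column r (flattening (glue ix \<mu>) (v (Suc \<mu>) l)) = (\<Sum>a<k \<mu>. c \<mu> l r a *\<^sub>R v \<mu> a)" if "\<mu> < d" for \<mu> l r
    using someI_ex[OF span_image_sum[OF slice[OF that]]] unfolding c_def .
  define G where "G \<mu> j = mat (k (\<mu> - 1)) (k \<mu>) (\<lambda>(a, l). c (\<mu> - 1) l (SOME r. ix r \<mu> = j) a)" for \<mu> j
  have Gc: "G \<mu> j \<in> carrier_mat (k (\<mu> - 1)) (k \<mu>)" for \<mu> j by (simp add: G_def)
  have core: "core_prod G (ix p) \<mu> $$ (0, l) = v \<mu> l $ p" if "\<mu> \<le> d" "l < k \<mu>" for p \<mu> l
    using that
  proof (induction \<mu> arbitrary: l)
    case 0
    then show ?case using k by (simp add: v_def)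
  next
    case (Suc \<mu>)
    \<comment> \<open>any multi-index with the same entry as \<open>p\<close> at position \<open>\<mu> + 1\<close>; the core may only depend on this entry\<close>
    define r where "r = (SOME r. ix r (Suc \<mu>) = ix p (Suc \<mu>))"
    have r: "ix r (Suc \<mu>) = ix p (Suc \<mu>)" unfolding r_def by (rule someI[of _ p]) simp
    have "core_prod G (ix p) (Suc \<mu>) $$ (0, l)
        = (\<Sum>a<k \<mu>. core_prod G (ix p) \<mu> $$ (0, a) * G (Suc \<mu>) (ix p (Suc \<mu>)) $$ (a, l))"
      unfolding core_prod.simps
      using core_prod_carrier[where d = d, of k G "ix p" \<mu>, OF k(1) Gc] Suc.prems Gc[of "Suc \<mu>"]
      by (intro index_mult_sum) auto
    also have "\<dots> = (\<Sum>a<k \<mu>. v \<mu> a $ p * c \<mu> l r a)"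
    proof (rule sum.cong)
      fix a assume "a \<in> {..<k \<mu>}"
      then have a: "a < k \<mu>" by simp
      have "G (Suc \<mu>) (ix p (Suc \<mu>)) $$ (a, l) = c \<mu> l r a"
        using a Suc.prems by (simp add: G_def r_def)
      moreover have "core_prod G (ix p) \<mu> $$ (0, a) = v \<mu> a $ p"
        using Suc.IH[OF _ a] Suc.prems by simp
      ultimately show "core_prod G (ix p) \<mu> $$ (0, a) * G (Suc \<mu>) (ix p (Suc \<mu>)) $$ (a, l) = v \<mu> a $ p * c \<mu> l r a"
        by (simp only:)
    qed simp
    also have "\<dots> = (\<Sum>a<k \<mu>. c \<mu> l r a *\<^sub>R v \<mu> a) $ p" by (simp add: mult.commute)
    also have "\<dots> = v (Suc \<mu>) l $ glue ix \<mu> p r"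
      using c[of \<mu> r l] Suc.prems by (simp add: column_flattening[symmetric])
    also have "\<dots> = v (Suc \<mu>) l $ glue ix (Suc \<mu>) (glue ix \<mu> p r) p"
      using colspace_left[OF band v_col] Suc.prems by simp
    also have "glue ix (Suc \<mu>) (glue ix \<mu> p r) p = p"
      by (rule ix_eqD[OF bij]) (auto simp: ix_glue[OF bij] fun_eq_iff le_Suc_eq r)
    finally show ?case .
  qed
  have "X $ p = core_prod G (ix p) d $$ (0, 0)" for p
    using core[of d 0 p] k d by (simp add: v_def)
  then show ?thesis unfolding has_tt_repr_def using k Gc by blast
qed

text \<open>The unfolding ranks are both attainable as a size and a lower bound for every size.\<close>
lemma tt_manifold_iff_ranks:
  fixes X :: "real^'i::finite"
  assumes d: "d \<ge> 1" and bij: "bij_betw ix UNIV (multi_indices d N)"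
  shows "X \<in> tt_manifold d N ix k \<longleftrightarrow>
    k 0 = 1 \<and> k d = 1 \<and> (\<forall>\<mu>\<in>{1..<d}. dim (colspace (glue ix \<mu>) X) = k \<mu>)"
proof
  assume "X \<in> tt_manifold d N ix k"
  then have repr: "has_tt_repr d N ix k X"
    and min: "\<And>k' \<mu>. has_tt_repr d N ix k' X \<Longrightarrow> \<mu> \<in> {1..<d} \<Longrightarrow> k \<mu> \<le> k' \<mu>"
    by (auto simp: tt_manifold_def has_tt_rank_def)
  \<comment> \<open>the unfolding ranks, with the prescribed boundary values\<close>
  define k' where "k' \<mu> = (if \<mu> \<in> {1..<d} then dim (colspace (glue ix \<mu>) X) else 1)" for \<mu>
  have repr': "has_tt_repr d N ix k' X"
    by (rule tt_repr_of_ranks[OF d bij]) (auto simp: k'_def)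
  have "k \<mu> \<le> dim (colspace (glue ix \<mu>) X)" if "\<mu> \<in> {1..<d}" for \<mu>
    using min[OF repr' that] that by (simp add: k'_def)
  moreover have "dim (colspace (glue ix \<mu>) X) \<le> k \<mu>" if "\<mu> \<in> {1..<d}" for \<mu>
    using rank_le_of_tt_repr[OF bij repr] that by simp
  ultimately show "k 0 = 1 \<and> k d = 1 \<and> (\<forall>\<mu>\<in>{1..<d}. dim (colspace (glue ix \<mu>) X) = k \<mu>)"
    using repr unfolding has_tt_repr_def by (blast intro: order_antisym)
next
  assume k: "k 0 = 1 \<and> k d = 1 \<and> (\<forall>\<mu>\<in>{1..<d}. dim (colspace (glue ix \<mu>) X) = k \<mu>)"
  then have "has_tt_repr d N ix k X" by (intro tt_repr_of_ranks[OF d bij]) auto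
  moreover have "k \<mu> \<le> k' \<mu>" if "has_tt_repr d N ix k' X" "\<mu> \<in> {1..<d}" for k' \<mu>
    using rank_le_of_tt_repr[OF bij that(1), of \<mu>] that(2) k by simp
  ultimately show "X \<in> tt_manifold d N ix k"
    by (auto simp: tt_manifold_def has_tt_rank_def)
qed

section \<open>The boundary of the set of tensors of fixed TT rank\<close>

lemma idempotent_inverse:
  fixes X :: "'a::real_vector"
  assumes "linear T" "T (T X) = T X" "t \<noteq> 1" "Z = X - t *\<^sub>R T X"
  shows "X = Z + (t / (1 - t)) *\<^sub>R T Z"
proof -
  have "T Z = (1 - t) *\<^sub>R T X"
    using assms(1,2) by (simp add: assms(4) linear_diff linear_cmul scaleR_left_diff_distrib)
  then have "(t / (1 - t)) *\<^sub>R T Z = t *\<^sub>R T X" using assms(3) by simp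
  then show ?thesis by (simp add: assms(4))
qed

lemma colspace_lincomb:
  assumes "colspace g Z \<subseteq> S" "colspace g W \<subseteq> S" "subspace S"
  shows "colspace g (Z + c *\<^sub>R W) \<subseteq> S"
  using assms(1,2) by (auto simp: colspace_subset_iff[OF assms(3)] column_simps
      intro!: subspace_add[OF assms(3)] subspace_scale[OF assms(3)])

lemma C1_differentiable_on_linear:
  fixes A :: "'a::euclidean_space \<Rightarrow> 'b::euclidean_space"
  assumes "linear A" "\<gamma> C1_differentiable_on S"
  shows "(\<lambda>t. A (\<gamma> t)) C1_differentiable_on S"
proof -
  have A: "bounded_linear A" using assms(1) by (simp add: linear_conv_bounded_linear)
  obtain D where D: "\<And>x. x \<in> S \<Longrightarrow> (\<gamma> has_vector_derivative D x) (at x)" "continuous_on S D"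
    using assms(2) unfolding C1_differentiable_on_def by blast
  show ?thesis unfolding C1_differentiable_on_def
    by (rule exI[of _ "\<lambda>x. A (D x)"])
      (use D in \<open>auto intro: bounded_linear.has_vector_derivative[OF A] bounded_linear.continuous_on[OF A]\<close>)
qed

context cut_family
begin

text \<open>With \<open>u = X w\<close> subtract from \<open>X\<close> the part \<open>T X\<close> whose columns are the projections of the columns of \<open>X\<close> onto
\<open>u\<close>. This is the rank-one tensor \<open>u \<otimes> c\<close>, where \<open>c = X\<^sup>T u / \<bar>u\<bar>\<^sup>2\<close>, and it can be written both as \<open>A X\<close> with an idempotent
\<open>A\<close> acting on the left and as \<open>B X\<close> with an idempotent \<open>B\<close> acting on the right. For \<open>t \<noteq> 1\<close> the maps
\<open>id - t A\<close> and \<open>id - t B\<close> are invertible, so the unfolding ranks to the right of the cut are kept because of \<open>A\<close>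
and those to the left because of \<open>B\<close>. For \<open>t = 1\<close> the direction \<open>u\<close> is lost at the cut itself.\<close>
lemma rank_one_removal:
  assumes \<mu>: "\<mu> \<in> {1..<d}" and u: "u \<in> colspace (g \<mu>) X" "u \<noteq> 0"
  obtains T where "linear T" "\<And>t. t \<noteq> 1 \<Longrightarrow> same_ranks X (X - t *\<^sub>R T X)"
    "\<not> same_ranks X (X - T X)"
    "norm (T X) * sqrt CARD('i) * norm u = norm (flattening (flip (g \<mu>)) X *v u)"
proof -
  define h where "h = g \<mu>"
  have bandh: "band h" unfolding h_def by (rule band)
  note hD = bandD[OF bandh]
  obtain w where w: "u = flattening h X *v w" using u(1) by (auto simp: colspace_def h_def)
  define \<kappa> where "\<kappa> = inner u u"
  have \<kappa>: "\<kappa> > 0" using u(2) by (simp add: \<kappa>_def)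
  define c where "c = (1 / \<kappa>) *\<^sub>R (flattening (flip h) X *v u)"
  have c_mem: "c \<in> colspace (flip h) X"
    unfolding c_def by (intro subspace_scale[OF subspace_colspace]) (simp add: colspace_def)
  have u_left: "u $ h p s = u $ p" for p s using colspace_left[OF bandh] u(1) by (simp add: h_def)
  have c_right: "c $ h s p = c $ p" for p s
    using colspace_left[OF band_flip[OF bandh] c_mem] by (simp add: flip_def)
  have c_ix: "c $ p = (1 / \<kappa>) * (\<Sum>q\<in>UNIV. u $ q * X $ h q p)" for p
    by (simp add: c_def flattening_mult flip_def mult.commute)
  define A where "A Z = (\<chi> p. \<Sum>q\<in>UNIV. (u $ p * u $ q / \<kappa>) * Z $ h q p)" for Z
  define B where "B Z = (\<chi> p. \<Sum>q\<in>UNIV. (c $ p * w $ q) * Z $ h p q)" for Z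
  have A_acts: "acts_right (flip (g \<mu>)) A"
    by (rule acts_rightI[where b = "\<lambda>p q. u $ p * u $ q / \<kappa>"])
      (simp_all add: A_def flip_def u_left h_def[symmetric])
  have B_acts: "acts_right (g \<mu>) B"
    by (rule acts_rightI[where b = "\<lambda>p q. c $ p * w $ q"])
      (simp_all add: B_def c_right h_def[symmetric])
  have A_ix: "A Z $ p = u $ p * ((1 / \<kappa>) * (\<Sum>q\<in>UNIV. u $ q * Z $ h q p))" for Z p
    by (simp add: A_def sum_distrib_left sum_divide_distrib mult.assoc)
  have B_ix: "B Z $ p = c $ p * (\<Sum>q\<in>UNIV. w $ q * Z $ h p q)" for Z p
    by (simp add: B_def sum_distrib_left mult.assoc)
  have AX: "A X $ p = u $ p * c $ p" for p by (simp add: A_ix c_ix)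
  have "B X $ p = c $ p * u $ p" for p by (simp add: B_ix w flattening_mult mult.commute)
  then have AB: "A X = B X" by (simp add: cart_eq_iff AX)
  have uu: "(\<Sum>q\<in>UNIV. u $ q * u $ q) = \<kappa>" by (simp add: \<kappa>_def inner_vec_def)
  \<comment> \<open>this normalisation makes \<open>B\<close> idempotent\<close>
  have wc: "(\<Sum>q\<in>UNIV. w $ q * c $ q) = 1"
  proof -
    have "inner w c = (1 / \<kappa>) * inner (flattening h X *v w) u"
      unfolding inner_flattening c_def by simp
    then show ?thesis using \<kappa> by (simp add: w[symmetric] \<kappa>_def[symmetric]) (simp add: inner_vec_def)
  qed
  have AA: "A (A X) = A X"
  proof -
    have "A (A X) $ p = u $ p * ((1 / \<kappa>) * ((\<Sum>q\<in>UNIV. u $ q * u $ q) * c $ p))" for p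
      by (simp add: A_ix[of "A X"] AX u_left c_right sum_distrib_right mult.assoc)
    then show ?thesis using \<kappa> by (simp add: cart_eq_iff uu AX)
  qed
  have BB: "B (B X) = B X"
  proof -
    have "(\<Sum>q\<in>UNIV. w $ q * (u $ p * c $ q)) = (\<Sum>q\<in>UNIV. w $ q * c $ q) * u $ p" for p
      by (subst sum_distrib_right) (rule sum.cong, simp_all)
    then have "B (B X) $ p = c $ p * ((\<Sum>q\<in>UNIV. w $ q * c $ q) * u $ p)" for p
      unfolding AB[symmetric] by (simp only: B_ix[of "A X"] AX u_left c_right)
    then have "B (B X) $ p = B X $ p" for p unfolding wc AB[symmetric] AX by simp
    then show ?thesis by (simp add: cart_eq_iff)
  qed
  have linA: "linear A" by (rule acts_right_linear[OF A_acts])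
  have linB: "linear B" by (rule acts_right_linear[OF B_acts])
  have ranks: "same_ranks X (X - t *\<^sub>R A X)" if t: "t \<noteq> 1" for t
    unfolding same_ranks_def
  proof
    fix \<nu> assume "\<nu> \<in> {1..<d}"
    define Z where "Z = X - t *\<^sub>R A X"
    show "dim (colspace (g \<nu>) X) = dim (colspace (g \<nu>) (X - t *\<^sub>R A X))"
    proof (cases "\<nu> \<le> \<mu>")
      case True
      have ZB: "Z = X - t *\<^sub>R B X" by (simp add: Z_def AB)
      have XB: "X = Z + (t / (1 - t)) *\<^sub>R B Z" by (rule idempotent_inverse[OF linB BB t ZB])
      have act: "acts_right (g \<mu>) (\<lambda>W. W + c *\<^sub>R B W)" for c
        by (rule acts_right_lincomb[OF acts_right_id[OF band] B_acts])
      have "colspace (g \<nu>) Z \<subseteq> colspace (g \<nu>) X"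
        using acts_mono(1)[OF True act[of "-t"], of X] by (simp add: ZB)
      moreover have "colspace (g \<nu>) X \<subseteq> colspace (g \<nu>) Z"
        using acts_mono(1)[OF True act[of "t / (1 - t)"], of Z] by (simp add: XB[symmetric])
      ultimately show ?thesis by (simp add: Z_def)
    next
      case False
      then have le: "\<mu> \<le> \<nu>" by simp
      have XA: "X = Z + (t / (1 - t)) *\<^sub>R A Z" by (rule idempotent_inverse[OF linA AA t Z_def])
      have act: "acts_right (flip (g \<mu>)) (\<lambda>W. W + c *\<^sub>R A W)" for c
        by (rule acts_right_lincomb[OF acts_right_id[OF bandf] A_acts])
      have "colspace (flip (g \<nu>)) Z \<subseteq> colspace (flip (g \<nu>)) X"
        using acts_mono(2)[OF le act[of "-t"], of X] by (simp add: Z_def)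
      moreover have "colspace (flip (g \<nu>)) X \<subseteq> colspace (flip (g \<nu>)) Z"
        using acts_mono(2)[OF le act[of "t / (1 - t)"], of Z] by (simp add: XA[symmetric])
      ultimately have "colspace (flip (g \<nu>)) X = colspace (flip (g \<nu>)) Z" by blast
      then show ?thesis unfolding Z_def[symmetric] by (metis dim_colspace_flip)
    qed
  qed
  have drop: "\<not> same_ranks X (X - A X)"
  proof
    assume "same_ranks X (X - A X)"
    then have dim: "dim (colspace h X) = dim (colspace h (X - A X))"
      using \<mu> by (auto simp: same_ranks_def h_def)
    have "acts_right (g \<mu>) (\<lambda>W. W + (-1) *\<^sub>R B W)"
      by (rule acts_right_lincomb[OF acts_right_id[OF band] B_acts])
    from acts_mono(1)[OF order_refl this, of X]
    have "colspace h (X - A X) \<subseteq> colspace h X" by (simp add: AB h_def)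
    then have "colspace h (X - A X) = colspace h X"
      by (rule subspace_dim_equal[OF subspace_colspace subspace_colspace]) (simp add: dim)
    \<comment> \<open>\<open>u\<close> would be in a column space to which it is orthogonal\<close>
    then obtain y where y: "u = flattening h (X - A X) *v y" using u(1) by (auto simp: colspace_def h_def)
    have "flattening (flip h) (X - A X) *v u = 0"
    proof -
      have "(\<Sum>q\<in>UNIV. u $ q * A X $ h q p) = \<kappa> * c $ p" for p
        by (simp add: AX u_left c_right uu[symmetric] sum_distrib_right mult.assoc)
      then have "(\<Sum>q\<in>UNIV. (X - A X) $ h q p * u $ q) = 0" for p
        using \<kappa> by (simp add: right_diff_distrib sum_subtractf mult.commute[of _ "u $ _"] c_ix)
      then show ?thesis by (simp add: cart_eq_iff flattening_mult flip_def)
    qed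
    then have "inner u u = 0" using inner_flattening[of h "X - A X" y u] y by simp
    then show False using u(2) by simp
  qed
  have size: "norm (A X) * sqrt CARD('i) * norm u = norm (flattening (flip h) X *v u)"
  proof -
    have "real CARD('i) * (norm (A X))\<^sup>2 = (\<Sum>p\<in>UNIV. \<Sum>s\<in>(UNIV::'i set). (u $ p)\<^sup>2 * (c $ p)\<^sup>2)"
    proof -
      have "(norm (A X))\<^sup>2 = (\<Sum>p\<in>UNIV. (u $ p)\<^sup>2 * (c $ p)\<^sup>2)"
        unfolding power2_norm_eq_inner inner_vec_def AX by (rule sum.cong) (simp_all add: power2_eq_square)
      then show ?thesis by (simp add: sum_distrib_left)
    qed
    also have "\<dots> = (\<Sum>p\<in>UNIV. \<Sum>s\<in>UNIV. (u $ h p s)\<^sup>2 * (c $ h p s)\<^sup>2)"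
      using sum_band[OF bandh, of "\<lambda>p s. (u $ p)\<^sup>2 * (c $ p)\<^sup>2"] by simp
    also have "\<dots> = (\<Sum>p\<in>UNIV. \<Sum>s\<in>UNIV. (u $ p)\<^sup>2 * (c $ s)\<^sup>2)" by (simp add: u_left c_right)
    also have "\<dots> = (norm u)\<^sup>2 * (norm c)\<^sup>2"
      by (simp add: power2_norm_eq_inner inner_vec_def sum_product[symmetric] power2_eq_square[symmetric])
    finally have n: "real CARD('i) * (norm (A X))\<^sup>2 = (norm u)\<^sup>2 * (norm c)\<^sup>2" .
    have "norm (flattening (flip h) X *v u) = \<kappa> * norm c" using \<kappa> by (simp add: c_def)
    then have "(norm (flattening (flip h) X *v u))\<^sup>2 = (norm u)\<^sup>2 * ((norm u)\<^sup>2 * (norm c)\<^sup>2)"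
      by (simp add: \<kappa>_def power2_norm_eq_inner[symmetric] power_mult_distrib power2_eq_square)
    also have "\<dots> = (norm (A X) * sqrt CARD('i) * norm u)\<^sup>2"
      by (simp add: n[symmetric] power_mult_distrib)
    finally show ?thesis by (simp add: power2_eq_iff_nonneg)
  qed
  show ?thesis by (rule that[OF linA ranks drop size[unfolded h_def]])
qed

text \<open>For \<open>X\<close> of TT rank \<open>k\<close> this is the manifold of TT rank \<open>k\<close>.\<close>
abbreviation stratum :: "real^'i \<Rightarrow> (real^'i) set" where
  "stratum X \<equiv> {Y. same_ranks X Y}"

text \<open>In the closure of the stratum ranks cannot grow, and near \<open>X\<close> they cannot drop, by semicontinuity.\<close>
lemma boundary_far:
  assumes s: "singular_bounds X s" and Y: "Y \<in> closure (stratum X) - stratum X"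
  shows "s \<le> dist X Y"
proof (rule ccontr)
  assume "\<not> s \<le> dist X Y"
  then have near: "norm (X - Y) < s" by (simp add: dist_norm)
  obtain r where r: "singular_bounds Y r" using singular_bounds_exists by blast
  then have "r > 0" by (simp add: singular_bounds_def)
  then obtain W where W: "same_ranks X W" "dist Y W < r"
    using Y closure_approachableD[of Y "stratum X" r] by auto
  have "same_ranks X Y" unfolding same_ranks_def
  proof
    fix \<mu> assume \<mu>: "\<mu> \<in> {1..<d}"
    have "dim (colspace (g \<mu>) Y) \<le> dim (colspace (g \<mu>) W)"
      using rank_le_near[OF r _ \<mu>] W(2) by (simp add: dist_norm)
    also have "\<dots> = dim (colspace (g \<mu>) X)" using W(1) \<mu> by (simp add: same_ranks_def)
    finally show "dim (colspace (g \<mu>) X) = dim (colspace (g \<mu>) Y)"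
      using rank_le_near[OF s near \<mu>] by simp
  qed
  then show False using Y by simp
qed

lemma boundary_near:
  assumes \<mu>: "\<mu> \<in> {1..<d}" and u: "u \<in> colspace (g \<mu>) X" "u \<noteq> 0"
  shows "\<exists>Z\<in>closure (stratum X) - stratum X.
    dist X Z * sqrt CARD('i) * norm u = norm (flattening (flip (g \<mu>)) X *v u)"
proof -
  obtain T where T: "\<And>t. t \<noteq> 1 \<Longrightarrow> same_ranks X (X - t *\<^sub>R T X)"
    "\<not> same_ranks X (X - T X)"
    "norm (T X) * sqrt CARD('i) * norm u = norm (flattening (flip (g \<mu>)) X *v u)"
    by (rule rank_one_removal[OF assms]) blast
  have "(\<lambda>t. X - t *\<^sub>R T X) ` closure {0..<1} \<subseteq> closure (stratum X)"
  proof (rule image_closure_subset)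
    show "continuous_on (closure {0..<1}) (\<lambda>t::real. X - t *\<^sub>R T X)" by (intro continuous_intros)
    have "(\<lambda>t. X - t *\<^sub>R T X) ` {0..<1} \<subseteq> stratum X" using T(1) by auto
    then show "(\<lambda>t. X - t *\<^sub>R T X) ` {0..<1} \<subseteq> closure (stratum X)"
      using closure_subset by (rule order_trans)
  qed simp
  then have "X - 1 *\<^sub>R T X \<in> closure (stratum X)"
    by (rule subsetD) (rule imageI, simp)
  then show ?thesis using T(2,3) by (intro bexI[of _ "X - T X"]) (auto simp: dist_norm)
qed

text \<open>The distance to the boundary is at most every nonzero singular value of every unfolding: for each \<open>u\<close> in a column space
\<open>boundary_near\<close> supplies a boundary point at distance \<open>\<bar>X\<^sup>T u\<bar> / \<bar>u\<bar>\<close> (up to the repetition factor).\<close>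
lemma infdist_singular_bounds:
  assumes ne: "closure (stratum X) - stratum X \<noteq> {}"
  shows "singular_bounds X (infdist X (closure (stratum X) - stratum X))"
proof -
  let ?B = "closure (stratum X) - stratum X"
  obtain s where s: "singular_bounds X s" using singular_bounds_exists by blast
  have "s \<le> infdist X ?B"
    unfolding infdist_notempty[OF ne] by (rule cINF_greatest[OF ne]) (rule boundary_far[OF s])
  then have pos: "infdist X ?B > 0" using s by (simp add: singular_bounds_def)
  have "singular_bound (g \<mu>) X (infdist X ?B)" if \<mu>: "\<mu> \<in> {1..<d}" for \<mu>
  proof (rule singular_bound_flip[OF _ pos])
    have "infdist X ?B * sqrt CARD('i) * norm u \<le> norm (flattening (flip (g \<mu>)) X *v u)"
      if u: "u \<in> colspace (g \<mu>) X" for u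
    proof (cases "u = 0")
      case False
      obtain Z where Z: "Z \<in> ?B" "dist X Z * sqrt CARD('i) * norm u = norm (flattening (flip (g \<mu>)) X *v u)"
        using boundary_near[OF \<mu> u False] by blast
      show ?thesis unfolding Z(2)[symmetric]
        by (intro mult_right_mono infdist_le[OF Z(1)]) simp_all
    qed simp
    then show "singular_bound (flip (g \<mu>)) X (infdist X ?B)" by (simp add: singular_bound_def)
  qed
  then show ?thesis using pos by (simp add: singular_bounds_def)
qed

text \<open>Without boundary points the first unfolding has no nonzero columns, so the stratum consists of the zero
tensor.\<close>
lemma no_boundary:
  assumes "closure (stratum X) - stratum X = {}" "d \<ge> 2" "same_ranks X Y"
  shows "Y = X"
proof -
  have one: "1 \<in> {1..<d}" using assms(2) by simp
  have zero: "W = 0" if "dim (colspace (g 1) W) = 0" for W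
  proof -
    have "column s (flattening (g 1) W) = column s (flattening (g 1) 0)" for s
    proof -
      have "column s (flattening (g 1) W) = 0"
        using that column_mem_colspace[of s "g 1" W] unfolding dim_eq_0 by blast
      moreover have "column s (flattening (g 1) 0) = 0"
        by (simp add: cart_eq_iff column_flattening)
      ultimately show ?thesis by (simp only:)
    qed
    then show ?thesis by (rule eq_by_columns[OF band])
  qed
  have "colspace (g 1) X \<subseteq> {0}"
    using boundary_near[OF one, of _ X] assms(1) by blast
  then have X0: "dim (colspace (g 1) X) = 0" unfolding dim_eq_0 .
  have "dim (colspace (g 1) X) = dim (colspace (g 1) Y)"
    using assms(3) one unfolding same_ranks_def by blast
  then have "dim (colspace (g 1) Y) = 0" using X0 by (simp only:)
  then show ?thesis using zero[of X] zero[of Y] X0 by blast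
qed

section \<open>The tangent space\<close>

text \<open>By \<open>norm_normal_proj_le\<close> the normal component of \<open>X - \<gamma> t\<close> is of second order in \<open>t\<close>.\<close>
lemma tangent_imp_kernel:
  assumes v: "v \<in> tangent_space (stratum X) X"
  shows "normal_proj X v = 0"
proof -
  obtain \<gamma> \<epsilon> where \<epsilon>: "\<epsilon> > 0" and M: "\<gamma> ` {-\<epsilon><..<\<epsilon>} \<subseteq> stratum X" and \<gamma>0: "\<gamma> 0 = X"
    and deriv: "(\<gamma> has_vector_derivative v) (at 0)"
    using v unfolding tangent_space_def by blast
  obtain s where s: "singular_bounds X s" using singular_bounds_exists by blast
  define C where "C = sqrt (real (d - 1)) / s"
  define q where "q t = (\<gamma> t - X) /\<^sub>R t" for t
  have q: "(q \<longlongrightarrow> v) (at 0)"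
  proof (rule LIM_zero_cancel, rule tendsto_norm_zero_cancel)
    have "((\<lambda>t. norm ((\<gamma> t - \<gamma> 0) - (t - 0) *\<^sub>R v) / norm (t - 0)) \<longlongrightarrow> 0) (at 0)"
      using deriv unfolding has_vector_derivative_def has_derivative_iff_norm by blast
    moreover have "\<forall>\<^sub>F t in at 0. norm ((\<gamma> t - \<gamma> 0) - (t - 0) *\<^sub>R v) / norm (t - 0) = norm (q t - v)"
    proof (rule eventually_at_topological[THEN iffD2], intro exI[of _ UNIV] conjI ballI impI)
      fix t :: real assume t: "t \<noteq> 0"
      then have "q t - v = (\<gamma> t - X - t *\<^sub>R v) /\<^sub>R t" by (simp add: q_def scaleR_diff_right)
      then show "norm ((\<gamma> t - \<gamma> 0) - (t - 0) *\<^sub>R v) / norm (t - 0) = norm (q t - v)"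
        by (simp add: \<gamma>0 divide_inverse mult.commute)
    qed auto
    ultimately show "((\<lambda>t. norm (q t - v)) \<longlongrightarrow> 0) (at 0)" by (rule Lim_transform_eventually)
  qed
  have cont: "(\<gamma> \<longlongrightarrow> X) (at 0)"
    using has_vector_derivative_continuous[OF deriv] \<gamma>0 by (simp add: isCont_def)
  have bl: "bounded_linear (normal_proj X)" using linear_normal_proj by (simp add: linear_conv_bounded_linear)
  have lhs: "((\<lambda>t. norm (normal_proj X (q t))) \<longlongrightarrow> norm (normal_proj X v)) (at 0)"
    by (rule tendsto_norm[OF bounded_linear.tendsto[OF bl q]])
  have rhs: "((\<lambda>t. C * norm (q t) * norm (X - \<gamma> t)) \<longlongrightarrow> C * norm v * norm (X - X)) (at 0)"
    by (rule tendsto_mult[OF tendsto_mult[OF tendsto_const tendsto_norm[OF q]]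
          tendsto_norm[OF tendsto_diff[OF tendsto_const cont]]])
  have "norm (normal_proj X (q t)) \<le> C * norm (q t) * norm (X - \<gamma> t)" if t: "t \<in> {-\<epsilon><..<\<epsilon>}" for t
  proof -
    have "norm (normal_proj X (X - \<gamma> t)) \<le> C * (norm (X - \<gamma> t))\<^sup>2"
      unfolding C_def by (rule norm_normal_proj_le[OF s]) (use M t in blast)
    then have "norm (normal_proj X (X - \<gamma> t)) / \<bar>t\<bar> \<le> C * (norm (X - \<gamma> t))\<^sup>2 / \<bar>t\<bar>" by (rule divide_right_mono) simp
    moreover have q_eq: "q t = (- inverse t) *\<^sub>R (X - \<gamma> t)" by (simp add: q_def scaleR_diff_right)
    have "norm (normal_proj X (q t)) = norm (normal_proj X (X - \<gamma> t)) / \<bar>t\<bar>"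
      unfolding q_eq linear_cmul[OF linear_normal_proj] by (simp add: divide_inverse)
    moreover have "C * norm (q t) * norm (X - \<gamma> t) = C * (norm (X - \<gamma> t))\<^sup>2 / \<bar>t\<bar>"
      unfolding q_eq by (simp add: power2_eq_square divide_inverse)
    ultimately show ?thesis by (simp only:)
  qed
  then have ev: "\<forall>\<^sub>F t in at 0. norm (normal_proj X (q t)) \<le> C * norm (q t) * norm (X - \<gamma> t)"
    unfolding eventually_at using \<epsilon> by (intro exI[of _ \<epsilon>]) (simp add: dist_norm abs_less_iff)
  have "norm (normal_proj X v) \<le> C * norm v * norm (X - X)"
    by (rule tendsto_le[OF _ rhs lhs ev]) simp
  then show ?thesis by simp
qed

text \<open>If the normal component of \<open>Z\<close> vanishes, then \<open>Z\<close> is the sum of \<open>L\<^bsub>d-1\<^esub> Z\<close> and the differences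
\<open>v = (L\<^sub>\<mu>\<^sub>-\<^sub>1 - L\<^sub>\<mu>) Z\<close> for \<open>1 \<le> \<mu> < d\<close>, and each of these is fixed by \<open>R\<^sub>\<mu>\<close>, hence \<open>v = A X\<close> with \<open>A\<close> acting to the left of the
cut \<open>\<mu>\<close>. The curve \<open>(id + t A\<^sub>1) \<cdots> (id + t A\<^bsub>d-1\<^esub>) (X + t L\<^bsub>d-1\<^esub> Z)\<close> has velocity \<open>Z\<close> at 0. It is built from
the right, the invariant being that the columns at the current cut \<open>m\<close> remain in the column space of \<open>X\<close>;
this bounds the ranks at the cuts up to \<open>m\<close>, and what acts to the left of a cut cannot raise the ranks
behind it.\<close>
lemma kernel_curve:
  assumes Z: "normal_proj X Z = 0" and m: "m \<le> d - 1"
  shows "\<exists>\<gamma>. \<gamma> C1_differentiable_on UNIV \<and> \<gamma> 0 = X \<and> (\<gamma> has_vector_derivative left_proj X m Z) (at 0) \<and>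
    (\<forall>t. (\<forall>\<nu>\<in>{1..<d}. dim (colspace (g \<nu>) (\<gamma> t)) \<le> dim (colspace (g \<nu>) X)) \<and>
         (m > 0 \<longrightarrow> colspace (g m) (\<gamma> t) \<subseteq> colspace (g m) X))"
  using m
proof (induction rule: inc_induct)
  case base
  let ?\<gamma> = "\<lambda>t. X + t *\<^sub>R left_proj X (d - 1) Z"
  have sub: "colspace (g (d - 1)) (?\<gamma> t) \<subseteq> colspace (g (d - 1)) X" if "d - 1 > 0" for t
    by (rule colspace_lincomb[OF order_refl left_proj_colspace subspace_colspace]) (use that in simp)
  have "dim (colspace (g \<nu>) (?\<gamma> t)) \<le> dim (colspace (g \<nu>) X)" if \<nu>: "\<nu> \<in> {1..<d}" for \<nu> t
  proof -
    have d: "d - 1 > 0" "\<nu> \<le> d - 1" using \<nu> by auto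
    obtain S where S: "acts_right (g (d - 1)) S" "?\<gamma> t = S X"
      by (rule colspace_subset_imp_acts_right[OF band sub[OF d(1)]])
    show ?thesis unfolding S(2) by (rule dim_subset[OF acts_mono(1)[OF d(2) S(1)]])
  qed
  moreover have "?\<gamma> C1_differentiable_on UNIV"
    by (intro C1_differentiable_on_add C1_differentiable_on_scaleR C1_differentiable_on_ident C1_differentiable_on_const)
  moreover have "(?\<gamma> has_vector_derivative left_proj X (d - 1) Z) (at 0)"
  proof -
    have "(?\<gamma> has_vector_derivative 0 + (0 *\<^sub>R 0 + 1 *\<^sub>R left_proj X (d - 1) Z)) (at 0)"
      by (intro has_vector_derivative_add has_vector_derivative_scaleR has_vector_derivative_const DERIV_ident)
    then show ?thesis by simp
  qed
  moreover have "?\<gamma> 0 = X" by simp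
  ultimately show ?case using sub by blast
next
  case (step m)
  define \<mu> where "\<mu> = Suc m"
  have \<mu>: "\<mu> \<in> {1..<d}" "\<mu> > 0" using step.hyps by (auto simp: \<mu>_def)
  obtain \<gamma> where \<gamma>: "\<gamma> C1_differentiable_on UNIV" "\<gamma> 0 = X" "(\<gamma> has_vector_derivative left_proj X \<mu> Z) (at 0)"
    and rank: "\<And>t \<nu>. \<nu> \<in> {1..<d} \<Longrightarrow> dim (colspace (g \<nu>) (\<gamma> t)) \<le> dim (colspace (g \<nu>) X)"
    and sub: "\<And>t. colspace (g \<mu>) (\<gamma> t) \<subseteq> colspace (g \<mu>) X"
    using step.IH unfolding \<mu>_def by blast
  define v where "v = left_step X \<mu> Z"
  have "normal_part X \<mu> Z = 0" using normal_part_normal_proj[OF \<mu>(1), of X Z] Z linear_0[OF linear_normal_part] by simp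
  then have "v = right_proj X \<mu> v" by (simp add: normal_part_alt v_def)
  then have "colspace (flip (g \<mu>)) v \<subseteq> colspace (flip (g \<mu>)) X"
    using colproj_colspace[OF bandf, of \<mu> X v] by (simp add: right_proj_def)
  then obtain A where A: "acts_right (flip (g \<mu>)) A" "v = A X"
    by (rule colspace_subset_imp_acts_right[OF bandf])
  have linA: "linear A" by (rule acts_right_linear[OF A(1)])
  have v_sub: "colspace (g m) v \<subseteq> colspace (g m) X" if "m > 0"
  proof -
    have "v = left_proj X m (Z - left_proj X \<mu> Z)"
      by (simp add: v_def left_step_def \<mu>_def linear_diff[OF linear_left_proj] left_proj_nested)
    then show ?thesis using left_proj_colspace[of m X] that by simp
  qed
  let ?\<gamma> = "\<lambda>t. \<gamma> t + t *\<^sub>R A (\<gamma> t)"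
  \<comment> \<open>\<open>\<gamma> t = S X\<close> with \<open>S\<close> acting on the right commutes with \<open>A\<close>, so the new curve is \<open>S (X + t v)\<close>\<close>
  have sub': "colspace (g m) (?\<gamma> t) \<subseteq> colspace (g m) X" if "m > 0" for t
  proof -
    obtain S where S: "acts_right (g \<mu>) S" "\<gamma> t = S X"
      by (rule colspace_subset_imp_acts_right[OF band sub])
    have "A (S X) = S (A X)" by (rule acts_right_commute[OF band band refines[OF order_refl] S(1) A(1)])
    then have "?\<gamma> t = S (X + t *\<^sub>R v)"
      using acts_right_linear[OF S(1)] by (simp add: S(2) A(2) linear_add linear_cmul)
    then have "colspace (g m) (?\<gamma> t) \<subseteq> colspace (g m) (X + t *\<^sub>R v)"
      using acts_mono(1)[OF _ S(1), of m] by (simp add: \<mu>_def)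
    also have "\<dots> \<subseteq> colspace (g m) X"
      by (rule colspace_lincomb[OF order_refl v_sub[OF that] subspace_colspace])
    finally show ?thesis .
  qed
  have "dim (colspace (g \<nu>) (?\<gamma> t)) \<le> dim (colspace (g \<nu>) X)" if \<nu>: "\<nu> \<in> {1..<d}" for \<nu> t
  proof (cases "\<nu> \<le> m")
    case True
    then have m: "m > 0" using \<nu> by simp
    obtain S where S: "acts_right (g m) S" "?\<gamma> t = S X"
      by (rule colspace_subset_imp_acts_right[OF band sub'[OF m]])
    show ?thesis unfolding S(2) by (rule dim_subset[OF acts_mono(1)[OF True S(1)]])
  next
    case False
    then have le: "\<mu> \<le> \<nu>" by (simp add: \<mu>_def)
    have "acts_right (flip (g \<mu>)) (\<lambda>W. W + t *\<^sub>R A W)"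
      by (rule acts_right_lincomb[OF acts_right_id[OF bandf] A(1)])
    from dim_subset[OF acts_mono(2)[OF le this, of "\<gamma> t"]]
    have "dim (colspace (g \<nu>) (?\<gamma> t)) \<le> dim (colspace (g \<nu>) (\<gamma> t))" by (simp add: dim_colspace_flip)
    also have "\<dots> \<le> dim (colspace (g \<nu>) X)" by (rule rank[OF \<nu>])
    finally show ?thesis .
  qed
  moreover have "?\<gamma> C1_differentiable_on UNIV"
    by (intro C1_differentiable_on_add C1_differentiable_on_scaleR C1_differentiable_on_ident
        C1_differentiable_on_linear[OF linA] \<gamma>(1))
  moreover have "(?\<gamma> has_vector_derivative left_proj X m Z) (at 0)"
  proof -
    have "bounded_linear A" using linA by (simp add: linear_conv_bounded_linear)
    note A' = bounded_linear.has_vector_derivative[OF this \<gamma>(3)]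
    have "(?\<gamma> has_vector_derivative (left_proj X \<mu> Z + (0 *\<^sub>R A (left_proj X \<mu> Z) + 1 *\<^sub>R A (\<gamma> 0)))) (at 0)"
      by (intro has_vector_derivative_add \<gamma>(3) has_vector_derivative_scaleR A' DERIV_ident)
    moreover have "left_proj X \<mu> Z + (0 *\<^sub>R A (left_proj X \<mu> Z) + 1 *\<^sub>R A (\<gamma> 0)) = left_proj X m Z"
      using A(2) by (simp add: \<gamma>(2) v_def left_step_def) (simp add: \<mu>_def algebra_simps)
    ultimately show ?thesis by simp
  qed
  moreover have "?\<gamma> 0 = X" using \<gamma>(2) by simp
  ultimately show ?case using sub' by blast
qed

text \<open>The ranks along the curve are at most those of \<open>X\<close>, and for small \<open>t\<close> at least those of \<open>X\<close>.\<close>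
lemma kernel_imp_tangent:
  assumes Z: "normal_proj X Z = 0"
  shows "Z \<in> tangent_space (stratum X) X"
proof -
  obtain \<gamma> where \<gamma>: "\<gamma> C1_differentiable_on UNIV" "\<gamma> 0 = X" "(\<gamma> has_vector_derivative Z) (at 0)"
    and rank: "\<And>t \<nu>. \<nu> \<in> {1..<d} \<Longrightarrow> dim (colspace (g \<nu>) (\<gamma> t)) \<le> dim (colspace (g \<nu>) X)"
    using kernel_curve[OF Z, of 0] by (auto simp: left_proj_def)
  obtain s where s: "singular_bounds X s" using singular_bounds_exists by blast
  then have s0: "s > 0" by (simp add: singular_bounds_def)
  have "isCont \<gamma> 0" by (rule has_vector_derivative_continuous[OF \<gamma>(3)])
  then obtain \<epsilon> where \<epsilon>: "\<epsilon> > 0" "\<And>t. dist t 0 < \<epsilon> \<Longrightarrow> dist (\<gamma> t) (\<gamma> 0) < s"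
    using s0 unfolding continuous_at_eps_delta by blast
  have "same_ranks X (\<gamma> t)" if t: "t \<in> {-\<epsilon><..<\<epsilon>}" for t
    unfolding same_ranks_def
  proof
    fix \<nu> assume \<nu>: "\<nu> \<in> {1..<d}"
    have "norm (X - \<gamma> t) < s" using \<epsilon>(2)[of t] t \<gamma>(2) by (simp add: dist_norm norm_minus_commute abs_less_iff)
    from rank_le_near[OF s this \<nu>] rank[OF \<nu>, of t]
    show "dim (colspace (g \<nu>) X) = dim (colspace (g \<nu>) (\<gamma> t))" by simp
  qed
  then show ?thesis unfolding tangent_space_def
    using \<epsilon>(1) \<gamma> C1_differentiable_on_subset[OF \<gamma>(1) subset_UNIV] by blast
qed

lemma tangent_space_stratum: "tangent_space (stratum X) X = {Z. normal_proj X Z = 0}"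
  using tangent_imp_kernel kernel_imp_tangent by blast

lemma orth_proj_tangent_space: "orth_proj (tangent_space (stratum X) X) Z = Z - normal_proj X Z"
  unfolding tangent_space_stratum
proof (rule orth_proj_eqI)
  show "subspace {Z. normal_proj X Z = 0}" by (rule linear_subspace_kernel[OF linear_normal_proj])
  show "Z - normal_proj X Z \<in> {Z. normal_proj X Z = 0}" by (simp add: linear_diff[OF linear_normal_proj] normal_proj_idem)
  show "inner (Z - (Z - normal_proj X Z)) v = 0" if "v \<in> {Z. normal_proj X Z = 0}" for v
    using that by (simp add: normal_proj_sym)
qed

end

section \<open>The curvature estimates\<close>

theorem proposition4p11:
  fixes d :: nat and N k :: "nat \<Rightarrow> nat"
    and ix :: "'i::finite \<Rightarrow> nat \<Rightarrow> nat"
    and X :: "real ^ 'i"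
  assumes "d \<ge> 1"
    and "bij_betw ix UNIV (multi_indices d N)"
    and "X \<in> tt_manifold d N ix k"
  shows "(\<forall>Y\<in>tt_manifold d N ix k.
            (SUP Z\<in>sphere 0 1. norm (tangent_proj d N ix k X Z - tangent_proj d N ix k Y Z))
              \<le> 4 * real d / boundary_dist d N ix k X * norm (X - Y) \<and>
            norm ((X - Y) - tangent_proj d N ix k X (X - Y))
              \<le> sqrt (real (d - 1)) / boundary_dist d N ix k X * (norm (X - Y))\<^sup>2) \<and>
         (\<forall>Y\<in>closure (tt_manifold d N ix k).
            norm ((X - Y) - tangent_proj d N ix k X (X - Y))
              \<le> sqrt (real (d - 1)) / boundary_dist d N ix k X * (norm (X - Y))\<^sup>2)"
proof -
  interpret cut_family "glue ix" d by (rule cut_family_glue[OF assms(2)])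
  define M where "M = tt_manifold d N ix k"
  define \<sigma> where "\<sigma> = boundary_dist d N ix k X"
  have M: "M = stratum Y" if "Y \<in> M" for Y
    using that unfolding M_def tt_manifold_iff_ranks[OF assms(1,2)] same_ranks_def set_eq_iff by auto
  have XM: "X \<in> M" using assms(3) by (simp add: M_def)
  have proj: "tangent_proj d N ix k Y Z = Z - normal_proj Y Z" if "Y \<in> M" for Y Z
    using orth_proj_tangent_space[of Y Z] M[OF that] by (simp add: tangent_proj_def M_def)
  have ranks: "same_ranks X Y" if "Y \<in> M" for Y using that M[OF XM] by blast
  have \<sigma>_eq: "\<sigma> = infdist X (closure (stratum X) - stratum X)"
    unfolding \<sigma>_def boundary_dist_def using M[OF XM] by (simp add: M_def)
  have \<sigma>0: "\<sigma> \<ge> 0" unfolding \<sigma>_eq by (rule infdist_nonneg)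
  have first: "norm (normal_proj X Z - normal_proj Y Z) \<le> 4 * real d / \<sigma> * norm (X - Y)"
    and second: "norm (normal_proj X (X - Y)) \<le> sqrt (real (d - 1)) / \<sigma> * (norm (X - Y))\<^sup>2"
    if Y: "Y \<in> M" and Z: "norm Z = 1" for Y Z
  proof -
    consider "closure (stratum X) - stratum X \<noteq> {}" | "closure (stratum X) - stratum X = {}" "d \<ge> 2" | "d = 1"
      using assms(1) by linarith
    then have "norm (normal_proj X Z - normal_proj Y Z) \<le> 4 * real d / \<sigma> * norm (X - Y) \<and>
      norm (normal_proj X (X - Y)) \<le> sqrt (real (d - 1)) / \<sigma> * (norm (X - Y))\<^sup>2"
    proof cases
      case 1
      then have \<sigma>: "singular_bounds X \<sigma>" unfolding \<sigma>_eq by (rule infdist_singular_bounds)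
      have "norm (normal_proj X Z - normal_proj Y Z) \<le> 3 * real (d - 1) * (norm (X - Y) / \<sigma>)"
        using norm_normal_proj_diff_le[OF \<sigma> ranks[OF Y], of Z] Z by simp
      also have "\<dots> \<le> 4 * real d * (norm (X - Y) / \<sigma>)"
        using \<sigma>0 by (intro mult_right_mono) auto
      finally show ?thesis using norm_normal_proj_le[OF \<sigma> ranks[OF Y]] by simp
    next
      \<comment> \<open>\<open>\<sigma> = 0\<close> as the distance to the empty set, and division by it gives 0, so the left-hand sides must vanish\<close>
      case 2
      then have "Y = X" using no_boundary ranks[OF Y] by blast
      then show ?thesis by (simp add: linear_0[OF linear_normal_proj])
    next
      case 3
      then have "{1..<d} = {}" by simp
      then have "normal_proj W V = 0" for W V by (simp only: normal_proj_def sum.empty)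
      then show ?thesis using \<sigma>0 by simp
    qed
    then show "norm (normal_proj X Z - normal_proj Y Z) \<le> 4 * real d / \<sigma> * norm (X - Y)"
      and "norm (normal_proj X (X - Y)) \<le> sqrt (real (d - 1)) / \<sigma> * (norm (X - Y))\<^sup>2" by auto
  qed
  define e :: "real^'i" where "e = axis undefined 1"
  have e: "norm e = 1" unfolding e_def by (rule norm_axis_1)
  have sup: "(SUP Z\<in>sphere 0 1. norm (tangent_proj d N ix k X Z - tangent_proj d N ix k Y Z))
      \<le> 4 * real d / \<sigma> * norm (X - Y)" if Y: "Y \<in> M" for Y
  proof (rule cSUP_least)
    show "sphere (0::real^'i) 1 \<noteq> {}" using e by (metis dist_0_norm empty_iff mem_sphere)
    fix Z :: "real^'i" assume "Z \<in> sphere 0 1"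
    then have "norm Z = 1" by simp
    from first[OF Y this]
    show "norm (tangent_proj d N ix k X Z - tangent_proj d N ix k Y Z) \<le> 4 * real d / \<sigma> * norm (X - Y)"
      by (simp add: proj[OF XM] proj[OF Y] norm_minus_commute)
  qed
  \<comment> \<open>both sides of the second estimate are continuous in \<open>Y\<close>, so it extends to the closure\<close>
  have "closed {Y. norm (normal_proj X (X - Y)) \<le> sqrt (real (d - 1)) / \<sigma> * (norm (X - Y))\<^sup>2}"
  proof (rule closed_Collect_le)
    have bl: "bounded_linear (normal_proj X)" using linear_normal_proj by (simp add: linear_conv_bounded_linear)
    have "continuous_on UNIV (\<lambda>Y. X - Y)" by (intro continuous_intros)
    then show "continuous_on UNIV (\<lambda>Y. norm (normal_proj X (X - Y)))"
      by (rule continuous_on_norm[OF bounded_linear.continuous_on[OF bl]])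
    show "continuous_on UNIV (\<lambda>Y. sqrt (real (d - 1)) / \<sigma> * (norm (X - Y))\<^sup>2)"
      by (intro continuous_on_mult continuous_on_const continuous_on_power continuous_on_norm
          continuous_on_diff continuous_on_id)
  qed
  moreover have "M \<subseteq> {Y. norm (normal_proj X (X - Y)) \<le> sqrt (real (d - 1)) / \<sigma> * (norm (X - Y))\<^sup>2}"
    using second[OF _ e] by blast
  ultimately have "closure M \<subseteq> {Y. norm (normal_proj X (X - Y)) \<le> sqrt (real (d - 1)) / \<sigma> * (norm (X - Y))\<^sup>2}"
    by (intro closure_minimal)
  then have clos: "norm ((X - Y) - tangent_proj d N ix k X (X - Y)) \<le> sqrt (real (d - 1)) / \<sigma> * (norm (X - Y))\<^sup>2"
    if "Y \<in> closure M" for Y using that by (auto simp: proj[OF XM])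
  show ?thesis unfolding M_def[symmetric] \<sigma>_def[symmetric]
  proof (intro conjI ballI)
    fix Y assume Y: "Y \<in> M"
    show "(SUP Z\<in>sphere 0 1. norm (tangent_proj d N ix k X Z - tangent_proj d N ix k Y Z))
        \<le> 4 * real d / \<sigma> * norm (X - Y)"
      by (rule sup[OF Y])
    show "norm ((X - Y) - tangent_proj d N ix k X (X - Y)) \<le> sqrt (real (d - 1)) / \<sigma> * (norm (X - Y))\<^sup>2"
      by (rule clos[OF subsetD[OF closure_subset Y]])
  qed (rule clos)
qed

end
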